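(* Let $S=S_1$ be a finite set of $n$ points in the Euclidean plane $\mathbb{R}^2$ which is not an exceptional configuration. Then $S_\infty$ is dense in the region $K(S)$.
   Context: For points $p,q\in\mathbb{R}^2$, $pq$ denotes the closed line segment joining them. Iterated intersections: given a finite set $S=S_1\subset\mathbb{R}^2$, define inductively for $i\ge 1$ $$L_i:=\Big\{pq \;\Big|\; p,q\in\bigcup_{j=1}^i S_j,\ p\ne q\Big\},\qquad S_{i+1}:=\{x \mid \{x\}=l\cap l' \text{ for some } l,l'\in L_i\},$$ and $S_\infty:=\bigcup_{i=1}^\infty S_i$. The candidate: $$K(S):=\bigcap_{p\in S}\ \bigcap_{H\supset S\setminus\{p\}}H,$$ where the inner intersection is over all closed half planes $H$ containing $S\setminus\{p\}$. Exceptional configurations: a finite set $S$ of $n$ points in the plane is an exceptional configuration if one of the following holds: (i) all $n$ points lie on a line; (ii) $n-1$ of the points lie on a line and the remaining point does not lie on this line; (iii) $n-2$ of the points lie on a line and the remaining two points lie strictly on opposite sides of this line; (iv) $n=6$ and $S$ consists of the three vertices of a non-degenerate triangle (outer points) together with three non-collinear points in the interior of this triangle (inner points), such that every pair of inner points is collinear with one of the outer points. (These are exactly the subsets of vertex sets of finite planar straight-line graphs in which every two vertices are joined by a path of length equal to their Euclidean distance.) "Dense in a region $R$" means that $S_\infty\cap R$ is dense in $R$. *)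

theory Defs
  imports "HOL-Analysis.Analysis"
begin

type_synonym point = "real^2"

definition segments :: "point set \<Rightarrow> point set set" where
  "segments A = {closed_segment p q | p q. p \<in> A \<and> q \<in> A \<and> p \<noteq> q}"

definition crossings :: "point set set \<Rightarrow> point set" where
  "crossings L = {x. \<exists>l\<in>L. \<exists>l'\<in>L. {x} = l \<inter> l'}"

(* The sequence starts at index 1; index 0 is a dummy. *)
function iterated :: "point set \<Rightarrow> nat \<Rightarrow> point set" where
  "iterated S 0 = {}"
| "iterated S (Suc 0) = S"
| "iterated S (Suc (Suc i)) = crossings (segments (\<Union>j\<in>{1..Suc i}. iterated S j))"
  by pat_completeness auto
termination
  by (relation "Wellfounded.measure snd") auto

definition iterated_limit :: "point set \<Rightarrow> point set" where
  "iterated_limit S = (\<Union>i\<in>{1..}. iterated S i)"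

definition closed_half_plane :: "point set \<Rightarrow> bool" where
  "closed_half_plane H \<longleftrightarrow> (\<exists>a b. a \<noteq> 0 \<and> H = {x. a \<bullet> x \<le> b})"

definition candidate :: "point set \<Rightarrow> point set" where
  "candidate S = (\<Inter>p\<in>S. \<Inter>{H. closed_half_plane H \<and> S - {p} \<subseteq> H})"

definition all_but_one_on_line :: "point set \<Rightarrow> bool" where
  "all_but_one_on_line S \<longleftrightarrow>
     (\<exists>p\<in>S. \<exists>a b. a \<noteq> 0 \<and> S - {p} \<subseteq> {x. a \<bullet> x = b} \<and> a \<bullet> p \<noteq> b)"

definition all_but_two_on_separating_line :: "point set \<Rightarrow> bool" where
  "all_but_two_on_separating_line S \<longleftrightarrow>
     (\<exists>p\<in>S. \<exists>q\<in>S. \<exists>a b. a \<noteq> 0 \<and> S - {p, q} \<subseteq> {x. a \<bullet> x = b} \<and> a \<bullet> p < b \<and> b < a \<bullet> q)"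

definition nested_triangles :: "point set \<Rightarrow> bool" where
  "nested_triangles S \<longleftrightarrow> card S = 6 \<and>
     (\<exists>Out Inn. S = Out \<union> Inn \<and> card Out = 3 \<and> card Inn = 3 \<and>
        \<not> collinear Out \<and> \<not> collinear Inn \<and> Inn \<subseteq> interior (convex hull Out) \<and>
        (\<forall>u\<in>Inn. \<forall>v\<in>Inn. u \<noteq> v \<longrightarrow> (\<exists>w\<in>Out. collinear {u, v, w})))"

definition exceptional :: "point set \<Rightarrow> bool" where
  "exceptional S \<longleftrightarrow> finite S \<and>
     (collinear S \<or> all_but_one_on_line S \<or> all_but_two_on_separating_line S \<or> nested_triangles S)"

definition dense_in :: "point set \<Rightarrow> point set \<Rightarrow> bool" where
  "dense_in A R \<longleftrightarrow> R \<subseteq> closure (A \<inter> R)"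

end

(*
The set X of all iterated crossings, and hence its closure E, is closed under transversal crossings.

Local density. Call a triangle r p q with vertices in E cut if E contains a point a inside the side
rp and a point b inside the side rq. In the projective chart with r at the origin, a = (1,0),
b = (0,1) and p, q at infinity, two points u, v of E on ab give the crossing t of pv and qu, and
then the crossing of rt with ab lies strictly between u and v. So E has no gap on ab; it contains
ab, and then every crossing of pv with qu, which is an open set.

Growth. Beyond a tangent line of a ball in E at a point b of the interior of K(S) there are two
points p, q of S; points near b are crossings of segments from p and from q into the ball. So a
nonempty interior of E inside K(S) fills K(S).

Exceptional sets. Suppose that E contains no cut triangle. If o lies between a and b, then the
points of E strictly on one side of ab lie on one ray from o. If two segments of S cross, this
puts S on two lines and leads to case (iii). Otherwise a triangle A B C of maximal area contains S.
A further point on its boundary leads to (ii) or (iii). If all further points are interior, any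
two of them are collinear with a vertex (else four points of S are in convex position); in
logarithmic barycentric coordinates their differences have only three directions, so all of them
lie on a line through a vertex, which is (iii), or there are just three of them, which is (iv).
*)
theory Submission
  imports Defs
begin

section \<open>Determinants and transversal crossings\<close>

definition det2 :: "point \<Rightarrow> point \<Rightarrow> real" where
  "det2 u v = u$1 * v$2 - u$2 * v$1"

lemma det2_add_left: "det2 (u + v) w = det2 u w + det2 v w"
  and det2_add_right: "det2 w (u + v) = det2 w u + det2 w v"
  and det2_diff_left: "det2 (u - v) w = det2 u w - det2 v w"
  and det2_diff_right: "det2 w (u - v) = det2 w u - det2 w v"
  and det2_minus_left: "det2 (- u) w = - det2 u w"
  and det2_minus_right: "det2 w (- u) = - det2 w u"
  and det2_scaleR_left: "det2 (k *\<^sub>R u) w = k * det2 u w"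
  and det2_scaleR_right: "det2 w (k *\<^sub>R u) = k * det2 w u"
  by (simp_all add: det2_def algebra_simps)

lemma det2_self [simp]: "det2 u u = 0"
  and det2_zero_left [simp]: "det2 0 u = 0"
  and det2_zero_right [simp]: "det2 u 0 = 0"
  by (simp_all add: det2_def)

lemma det2_swap: "det2 v u = - det2 u v"
  by (simp add: det2_def)

lemmas det2_linear = det2_add_left det2_add_right det2_diff_left det2_diff_right
  det2_minus_left det2_minus_right det2_scaleR_left det2_scaleR_right

lemma tendsto_det2 [tendsto_intros]:
  "(f \<longlongrightarrow> u) F \<Longrightarrow> (g \<longlongrightarrow> v) F \<Longrightarrow> ((\<lambda>x. det2 (f x) (g x)) \<longlongrightarrow> det2 u v) F"
  unfolding det2_def by (intro tendsto_intros)

text \<open>Cramer's rule. It supplies the parameters of crossing points and the coordinates of a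
  point with respect to two transversal directions.\<close>

lemma det2_basis:
  assumes "det2 u v \<noteq> 0"
  shows "w = (det2 w v / det2 u v) *\<^sub>R u + (det2 u w / det2 u v) *\<^sub>R v"
proof -
  have "det2 u v *\<^sub>R w = det2 w v *\<^sub>R u + det2 u w *\<^sub>R v"
    by (simp add: vec_eq_iff forall_2 det2_def algebra_simps)
  then have "(1 / det2 u v) *\<^sub>R (det2 u v *\<^sub>R w) = (1 / det2 u v) *\<^sub>R (det2 w v *\<^sub>R u + det2 u w *\<^sub>R v)"
    by simp
  then show ?thesis
    using assms by (simp add: scaleR_add_right)
qed

text \<open>The quarter turn. It makes a direction into a normal vector, and so carries determinant
  conditions over to the equations \<open>a \<bullet> x = b\<close> that describe lines in the
  exceptional cases.\<close>

definition rot :: "point \<Rightarrow> point" where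
  "rot u = vector [- (u$2), u$1]"

lemma inner_rot: "rot u \<bullet> x = det2 u x"
  by (simp add: rot_def det2_def inner_vec_def sum_2)

lemma rot_eq_0_iff [simp]: "rot u = 0 \<longleftrightarrow> u = 0"
  by (auto simp: rot_def vec_eq_iff forall_2)

lemma collinear_iff_det2: "collinear {a, b, c} \<longleftrightarrow> det2 (b - a) (c - a) = 0"
proof
  assume "collinear {a, b, c}"
  then consider "a = c" | u where "b = u *\<^sub>R a + (1 - u) *\<^sub>R c"
    unfolding collinear_3_expand by blast
  then show "det2 (b - a) (c - a) = 0"
  proof cases
    case 2
    have "b - a = (1 - u) *\<^sub>R (c - a)" unfolding 2 by (simp add: algebra_simps)
    then show ?thesis by (simp add: det2_scaleR_left)
  qed simp
next
  assume 0: "det2 (b - a) (c - a) = 0"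
  show "collinear {a, b, c}"
  proof (cases "a = c")
    case False
    then have "c - a \<noteq> 0" by simp
    then have "(c - a) \<bullet> (c - a) \<noteq> 0" by simp
    define k where "k = ((b - a) \<bullet> (c - a)) / ((c - a) \<bullet> (c - a))"
    \<comment> \<open>With \<open>w = c - a\<close> and \<open>v = b - a\<close>, the left side
      minus the right side is \<open>det2 w v *\<^sub>R rot w\<close>, which vanishes by
      assumption.\<close>
    have par: "((c - a) \<bullet> (c - a)) *\<^sub>R (b - a) = ((b - a) \<bullet> (c - a)) *\<^sub>R (c - a)"
      using 0 unfolding vec_eq_iff forall_2 det2_def inner_vec_def sum_2
      by (simp, algebra)
    have "b - a = k *\<^sub>R (c - a)"
      using arg_cong[OF par, of "(*\<^sub>R) (1 / ((c - a) \<bullet> (c - a)))"]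
        \<open>(c - a) \<bullet> (c - a) \<noteq> 0\<close> unfolding k_def by simp
    then have "b = (1 - k) *\<^sub>R a + (1 - (1 - k)) *\<^sub>R c"
      by (simp add: algebra_simps)
    then show ?thesis unfolding collinear_3_expand by blast
  qed (simp add: insert_commute)
qed

section \<open>Transversal crossings and their stability under limits\<close>

lemma in_open_segment_iff:
  fixes x :: "'a::real_vector"
  shows "x \<in> open_segment a b \<longleftrightarrow> a \<noteq> b \<and> (\<exists>s. 0 < s \<and> s < 1 \<and> x = a + s *\<^sub>R (b - a))"
  by (simp add: in_segment algebra_simps)

text \<open>Only crossings that are interior to both segments and transversal are required. Such a
  crossing depends continuously on the four endpoints, which is what lets the property pass to
  closures.\<close>

definition crossing_closed :: "point set \<Rightarrow> bool" where
  "crossing_closed E \<longleftrightarrow> (\<forall>a\<in>E. \<forall>b\<in>E. \<forall>c\<in>E. \<forall>d\<in>E. \<forall>z.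
     z \<in> open_segment a b \<longrightarrow> z \<in> open_segment c d \<longrightarrow> det2 (a - z) (c - z) \<noteq> 0 \<longrightarrow> z \<in> E)"

lemma crossing_closedD:
  "crossing_closed E \<Longrightarrow> z \<in> open_segment a b \<Longrightarrow> z \<in> open_segment c d \<Longrightarrow>
   a \<in> E \<Longrightarrow> b \<in> E \<Longrightarrow> c \<in> E \<Longrightarrow> d \<in> E \<Longrightarrow> det2 (a - z) (c - z) \<noteq> 0 \<Longrightarrow> z \<in> E"
  unfolding crossing_closed_def by blast

text \<open>Approximate the four endpoints by points of \<open>E\<close>. A transversal crossing
  survives small perturbations, so the approximating segments eventually cross in points of
  \<open>E\<close>, and these converge to \<open>z\<close>.\<close>

lemma crossing_closed_closure:
  assumes "crossing_closed E"
  shows "crossing_closed (closure E)"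
  unfolding crossing_closed_def
proof (intro ballI allI impI)
  fix a b c d z
  assume mem: "a \<in> closure E" "b \<in> closure E" "c \<in> closure E" "d \<in> closure E"
    and zab: "z \<in> open_segment a b" and zcd: "z \<in> open_segment c d"
    and det: "det2 (a - z) (c - z) \<noteq> 0"
  obtain s where s: "0 < s" "s < 1" "z = a + s *\<^sub>R (b - a)"
    using zab unfolding in_open_segment_iff by blast
  obtain t where t: "0 < t" "t < 1" "z = c + t *\<^sub>R (d - c)"
    using zcd unfolding in_open_segment_iff by blast
  have "a - z = - s *\<^sub>R (b - a)" "c - z = - t *\<^sub>R (d - c)"
    using s t by (metis add_diff_cancel_left' minus_diff_eq scaleR_minus_left)+
  then have det': "det2 (b - a) (d - c) \<noteq> 0"
    using det by (metis det2_scaleR_left det2_scaleR_right mult_zero_right)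
  have ca: "c - a = s *\<^sub>R (b - a) - t *\<^sub>R (d - c)"
    using s t by (metis (no_types, lifting) add_diff_cancel_left' add_diff_cancel_right' diff_add_cancel diff_diff_eq2 add.commute)
  obtain a' where a': "\<And>n. a' n \<in> E" "a' \<longlonglongrightarrow> a" using mem closure_sequential by blast
  obtain b' where b': "\<And>n. b' n \<in> E" "b' \<longlonglongrightarrow> b" using mem closure_sequential by blast
  obtain c' where c': "\<And>n. c' n \<in> E" "c' \<longlonglongrightarrow> c" using mem closure_sequential by blast
  obtain d' where d': "\<And>n. d' n \<in> E" "d' \<longlonglongrightarrow> d" using mem closure_sequential by blast
  \<comment> \<open>Cramer's solution of
    \<open>a' + \<sigma> (b' - a') = c' + \<tau> (d' - c')\<close>. Division by zero can occur only
    for finitely many indices, which do not affect the limit.\<close>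
  define D where "D = (\<lambda>n. det2 (b' n - a' n) (d' n - c' n))"
  define \<sigma> where "\<sigma> = (\<lambda>n. det2 (c' n - a' n) (d' n - c' n) / D n)"
  define \<tau> where "\<tau> = (\<lambda>n. - (det2 (b' n - a' n) (c' n - a' n) / D n))"
  define z' where "z' = (\<lambda>n. a' n + \<sigma> n *\<^sub>R (b' n - a' n))"
  have D: "D \<longlonglongrightarrow> det2 (b - a) (d - c)"
    unfolding D_def by (intro tendsto_intros a' b' c' d')
  have "\<sigma> \<longlonglongrightarrow> det2 (c - a) (d - c) / det2 (b - a) (d - c)"
    unfolding \<sigma>_def by (intro tendsto_intros a' b' c' d' D det')
  then have \<sigma>: "\<sigma> \<longlonglongrightarrow> s"
    using det' unfolding ca by (simp add: det2_diff_left det2_scaleR_left)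
  have "\<tau> \<longlonglongrightarrow> - (det2 (b - a) (c - a) / det2 (b - a) (d - c))"
    unfolding \<tau>_def by (intro tendsto_intros a' b' c' d' D det')
  then have \<tau>: "\<tau> \<longlonglongrightarrow> t"
    using det' unfolding ca by (simp add: det2_diff_right det2_scaleR_right)
  have z': "z' \<longlonglongrightarrow> z"
    unfolding z'_def s(3) by (intro tendsto_intros a' b' \<sigma>)
  have ev: "\<forall>\<^sub>F n in sequentially. D n \<noteq> 0"
    using D det' by (rule tendsto_imp_eventually_ne)
  have "\<forall>\<^sub>F n in sequentially. z' n \<in> E"
    using ev order_tendstoD(1)[OF \<sigma> s(1)] order_tendstoD(2)[OF \<sigma> s(2)]
      order_tendstoD(1)[OF \<tau> t(1)] order_tendstoD(2)[OF \<tau> t(2)]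
  proof eventually_elim
    case (elim n)
    let ?u = "b' n - a' n" and ?v = "d' n - c' n"
    have "c' n - a' n = \<sigma> n *\<^sub>R ?u + (- \<tau> n) *\<^sub>R ?v"
      using det2_basis[of ?u ?v "c' n - a' n"] elim(1) by (simp add: \<sigma>_def \<tau>_def D_def)
    then have z2: "z' n = c' n + \<tau> n *\<^sub>R ?v"
      unfolding z'_def by (simp add: algebra_simps)
    have neq: "a' n \<noteq> b' n" "c' n \<noteq> d' n"
      using elim(1) unfolding D_def by auto
    have "det2 (a' n - z' n) (c' n - z' n) = \<sigma> n * \<tau> n * D n"
    proof -
      have "a' n - z' n = (- \<sigma> n) *\<^sub>R ?u" by (simp add: z'_def)
      moreover have "c' n - z' n = (- \<tau> n) *\<^sub>R ?v" unfolding z2 by simp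
      ultimately show ?thesis by (simp only: det2_scaleR_left det2_scaleR_right D_def) simp
    qed
    then have "det2 (a' n - z' n) (c' n - z' n) \<noteq> 0" using elim by simp
    moreover have "z' n \<in> open_segment (a' n) (b' n)"
      unfolding in_open_segment_iff using neq elim z'_def by blast
    moreover have "z' n \<in> open_segment (c' n) (d' n)"
      unfolding in_open_segment_iff using neq elim z2 by blast
    ultimately show ?case
      using crossing_closedD[OF assms _ _ a'(1) b'(1) c'(1) d'(1)] by simp
  qed
  then have "\<forall>\<^sub>F n in sequentially. z' n \<in> closure E"
    by (rule eventually_mono) (use closure_subset in blast)
  from Lim_in_closed_set[OF closed_closure this _ z'] show "z \<in> closure E" by simp
qed

section \<open>Cut triangles\<close>

definition cut_triangle :: "point set \<Rightarrow> bool" where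
  "cut_triangle E \<longleftrightarrow> (\<exists>r\<in>E. \<exists>p\<in>E. \<exists>q\<in>E. \<exists>a\<in>E. \<exists>b\<in>E.
     det2 (p - r) (q - r) \<noteq> 0 \<and> a \<in> open_segment r p \<and> b \<in> open_segment r q)"

text \<open>A projective map on the closed first quadrant. The origin goes to \<open>r\<close>, the
  points (1,0) and (0,1) go to \<open>r + P/(1+A)\<close> and \<open>r + R/(1+B)\<close>, and the
  points at infinity of the two axes correspond to \<open>r + P/A\<close> and
  \<open>r + R/B\<close>. Lines go to lines.\<close>

definition chart :: "point \<Rightarrow> point \<Rightarrow> point \<Rightarrow> real \<Rightarrow> real \<Rightarrow> real \<Rightarrow> real \<Rightarrow> point" where
  "chart r P R A B x y = r + (x / (1 + A * x + B * y)) *\<^sub>R P + (y / (1 + A * x + B * y)) *\<^sub>R R"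

lemma chart_swap: "chart r P R A B x y = chart r R P B A y x"
  by (simp add: chart_def algebra_simps)

lemma det2_combination:
  "det2 (a *\<^sub>R P + b *\<^sub>R R) (c *\<^sub>R P + d *\<^sub>R R) = (a * d - b * c) * det2 P R"
  by (simp add: det2_def algebra_simps)

lemma combination_eq_iff:
  assumes "det2 P R \<noteq> 0"
  shows "a *\<^sub>R P + b *\<^sub>R R = c *\<^sub>R P + d *\<^sub>R R \<longleftrightarrow> a = c \<and> b = d"
proof
  assume eq: "a *\<^sub>R P + b *\<^sub>R R = c *\<^sub>R P + d *\<^sub>R R"
  have "a * det2 P R = c * det2 P R"
    using arg_cong[OF eq, of "\<lambda>w. det2 w R"] by (simp add: det2_linear)
  moreover have "b * det2 P R = d * det2 P R"
    using arg_cong[OF eq, of "det2 P"] by (simp add: det2_linear)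
  ultimately show "a = c \<and> b = d" using assms by simp
qed simp

context
  fixes r P R :: point and A B :: real
  assumes A: "A > 0" and B: "B > 0" and PR: "det2 P R \<noteq> 0"
begin

lemma chart_denominator_pos: "x \<ge> 0 \<Longrightarrow> y \<ge> 0 \<Longrightarrow> 1 + A * x + B * y > 0"
  using A B by (smt (verit) mult_nonneg_nonneg)

lemma chart_eq_iff:
  assumes "x \<ge> 0" "y \<ge> 0" "x' \<ge> 0" "y' \<ge> 0"
  shows "chart r P R A B x y = chart r P R A B x' y' \<longleftrightarrow> x = x' \<and> y = y'"
proof
  define N where "N = 1 + A * x + B * y"
  define N' where "N' = 1 + A * x' + B * y'"
  have N: "N > 0" "N' > 0"
    unfolding N_def N'_def using chart_denominator_pos assms by auto
  assume "chart r P R A B x y = chart r P R A B x' y'"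
  then have eq: "x / N = x' / N'" "y / N = y' / N'"
    unfolding chart_def N_def[symmetric] N'_def[symmetric]
    using combination_eq_iff[OF PR] by (simp_all add: add.assoc)
  \<comment> \<open>The denominator can be read off from the image point; once the denominators
    agree, so do the numerators.\<close>
  have "1 / N = 1 - A * (x / N) - B * (y / N)"
  proof -
    have "N - A * x - B * y = 1" unfolding N_def by simp
    then have "1 / N = (N - A * x - B * y) / N" by simp
    also have "\<dots> = 1 - A * (x / N) - B * (y / N)"
      using N by (simp add: diff_divide_distrib)
    finally show ?thesis .
  qed
  moreover have "1 / N' = 1 - A * (x' / N') - B * (y' / N')"
  proof -
    have "N' - A * x' - B * y' = 1" unfolding N'_def by simp
    then have "1 / N' = (N' - A * x' - B * y') / N'" by simp
    also have "\<dots> = 1 - A * (x' / N') - B * (y' / N')"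
      using N by (simp add: diff_divide_distrib)
    finally show ?thesis .
  qed
  ultimately have "1 / N = 1 / N'" unfolding eq by simp
  then have "N = N'" using N by simp
  then show "x = x' \<and> y = y'" using eq N by simp
qed simp

text \<open>Since the denominators are positive, the projective map preserves betweenness. It only
  reweights the endpoints by their denominators, so the parameter \<open>s\<close> becomes
  \<open>s * N' / M\<close>.\<close>

lemma chart_in_open_segment:
  assumes nn: "x \<ge> 0" "y \<ge> 0" "x' \<ge> 0" "y' \<ge> 0" and ne: "x \<noteq> x' \<or> y \<noteq> y'"
    and s: "0 < s" "s < 1"
  shows "chart r P R A B ((1 - s) * x + s * x') ((1 - s) * y + s * y')
         \<in> open_segment (chart r P R A B x y) (chart r P R A B x' y')"
proof -
  define N where "N = 1 + A * x + B * y"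
  define N' where "N' = 1 + A * x' + B * y'"
  define M where "M = (1 - s) * N + s * N'"
  have N: "N > 0" "N' > 0"
    unfolding N_def N'_def using chart_denominator_pos nn by auto
  then have M: "M > 0" using s unfolding M_def by (simp add: add_pos_pos)
  have Meq: "1 + A * ((1 - s) * x + s * x') + B * ((1 - s) * y + s * y') = M"
    unfolding M_def N_def N'_def by algebra
  define l where "l = s * N' / M"
  have l1: "1 - l = (1 - s) * N / M"
    unfolding l_def using M by (simp add: field_simps) (simp add: M_def algebra_simps)
  have l: "0 < l" "l < 1"
  proof -
    show "0 < l" unfolding l_def using s N M by simp
    have "1 - l > 0" unfolding l1 using s N M by simp
    then show "l < 1" by simp
  qed
  have coef: "((1 - s) * u + s * u') / M = (1 - l) * (u / N) + l * (u' / N')" for u u'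
    unfolding l1 using N M by (simp add: l_def field_simps)
  have "chart r P R A B ((1 - s) * x + s * x') ((1 - s) * y + s * y')
      = (1 - l) *\<^sub>R chart r P R A B x y + l *\<^sub>R chart r P R A B x' y'"
    unfolding chart_def Meq N_def[symmetric] N'_def[symmetric] coef
    by (simp add: algebra_simps)
  moreover have "chart r P R A B x y \<noteq> chart r P R A B x' y'"
    using ne chart_eq_iff nn by blast
  ultimately show ?thesis unfolding in_segment using l by blast
qed

text \<open>A horizontal ray of the chart runs towards the image of the point at infinity of the
  first axis, so increasing \<open>x\<close> moves the image towards that apex. The parameter is the
  ratio of the two denominators.\<close>

lemma chart_in_open_segment_apex:
  assumes nn: "x' \<ge> 0" "y \<ge> 0" and less: "x' < x"
  shows "chart r P R A B x y \<in> open_segment (r + (1 / A) *\<^sub>R P) (chart r P R A B x' y)"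
proof -
  define N where "N = 1 + A * x + B * y"
  define N' where "N' = 1 + A * x' + B * y"
  have N: "N > 0" "N' > 0"
    unfolding N_def N'_def using chart_denominator_pos nn less by auto
  have N'N: "N' < N" unfolding N_def N'_def using A less by simp
  define l where "l = N' / N"
  have l: "0 < l" "l < 1" using N N'N unfolding l_def by auto
  have "x / N = (1 - l) * (1 / A) + l * (x' / N')"
    using N A unfolding l_def by (simp add: field_simps) (simp add: N_def N'_def algebra_simps)
  moreover have "y / N = l * (y / N')" using N unfolding l_def by simp
  ultimately have "chart r P R A B x y
      = (1 - l) *\<^sub>R (r + (1 / A) *\<^sub>R P) + l *\<^sub>R chart r P R A B x' y"
    unfolding chart_def N_def[symmetric] N'_def[symmetric]
    by (simp only:) (simp add: algebra_simps)
  moreover have "r + (1 / A) *\<^sub>R P \<noteq> chart r P R A B x' y"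
  proof
    assume "r + (1 / A) *\<^sub>R P = chart r P R A B x' y"
    then have "(1 / A) *\<^sub>R P + 0 *\<^sub>R R = (x' / N') *\<^sub>R P + (y / N') *\<^sub>R R"
      unfolding chart_def N'_def by (simp add: add.assoc)
    then have "1 / A = x' / N'" "0 = y / N'"
      unfolding combination_eq_iff[OF PR] by auto
    then have "N' = A * x'" "y = 0" using A N by (auto simp: field_simps)
    then show False unfolding N'_def by simp
  qed
  ultimately show ?thesis unfolding in_segment using l by blast
qed

end

text \<open>A missing point would lie in a maximal gap. By closedness both ends of this gap belong
  to \<open>T\<close>, and then \<open>gapless\<close> puts a point of \<open>T\<close> inside
  it.\<close>

lemma unit_interval_subset_gapless:
  fixes T :: "real set"
  assumes "closed T" "0 \<in> T" "1 \<in> T"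
    and gapless: "\<And>x y. x \<in> T \<Longrightarrow> y \<in> T \<Longrightarrow> x < y \<Longrightarrow> \<exists>z\<in>T. x < z \<and> z < y"
  shows "{0..1} \<subseteq> T"
proof
  fix x :: real
  assume x: "x \<in> {0..1}"
  show "x \<in> T"
  proof (rule ccontr)
    assume "x \<notin> T"
    define u where "u = Sup (T \<inter> {..x})"
    define v where "v = Inf (T \<inter> {x..})"
    have bdd: "bdd_above (T \<inter> {..x})" "bdd_below (T \<inter> {x..})" by auto
    have u: "u \<in> T \<inter> {..x}"
      unfolding u_def using assms x by (intro closed_contains_Sup bdd closed_Int) auto
    have v: "v \<in> T \<inter> {x..}"
      unfolding v_def using assms x by (intro closed_contains_Inf bdd closed_Int) auto
    have "u < x" "x < v" using u v \<open>x \<notin> T\<close> by (auto simp: less_le)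
    then obtain z where z: "z \<in> T" "u < z" "z < v" using gapless[of u v] u v by auto
    show False
    proof (cases "z \<le> x")
      case True
      then have "z \<le> u" unfolding u_def using z by (intro cSup_upper bdd) auto
      then show False using z by simp
    next
      case False
      then have "v \<le> z" unfolding v_def using z by (intro cInf_lower bdd) auto
      then show False using z by simp
    qed
  qed
qed

lemma cut_triangle_interior:
  assumes "closed E" and cc: "crossing_closed E" and "cut_triangle E"
  shows "interior E \<noteq> {}"
proof -
  obtain r p q a b where E: "r \<in> E" "p \<in> E" "q \<in> E" "a \<in> E" "b \<in> E"
    and det: "det2 (p - r) (q - r) \<noteq> 0"
    and ap: "a \<in> open_segment r p" and bq: "b \<in> open_segment r q"
    using assms(3) unfolding cut_triangle_def by blast
  obtain s where s: "0 < s" "s < 1" "a = r + s *\<^sub>R (p - r)"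
    using ap unfolding in_open_segment_iff by blast
  obtain t where t: "0 < t" "t < 1" "b = r + t *\<^sub>R (q - r)"
    using bq unfolding in_open_segment_iff by blast
  \<comment> \<open>Chosen so that \<open>A / (1 + A) = s\<close> and
    \<open>B / (1 + B) = t\<close>: with \<open>P\<close> and \<open>R\<close> below, the chart
    sends (1,0) to \<open>a\<close> and (0,1) to \<open>b\<close>, with \<open>p\<close> and
    \<open>q\<close> at infinity.\<close>
  define A where "A = s / (1 - s)"
  define B where "B = t / (1 - t)"
  define P where "P = A *\<^sub>R (p - r)"
  define R where "R = B *\<^sub>R (q - r)"
  have AB: "A > 0" "B > 0" unfolding A_def B_def using s t by auto
  have PR: "det2 P R \<noteq> 0"
    unfolding P_def R_def using det AB by (simp add: det2_scaleR_left det2_scaleR_right)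
  have p: "p = r + (1 / A) *\<^sub>R P" and q: "q = r + (1 / B) *\<^sub>R R"
    unfolding P_def R_def using AB by auto
  let ?c = "chart r P R A B"
  have r: "r = ?c 0 0" unfolding chart_def by simp
  have "1 / (1 + A) * A = s" "1 / (1 + B) * B = t"
    unfolding A_def B_def using s t by (auto simp: field_simps)
  then have a: "a = ?c 1 0" and b: "b = ?c 0 1"
    unfolding chart_def s(3) t(3) P_def R_def by simp_all
  have diff: "?c x y - ?c x' y' = (x / (1 + A * x + B * y) - x' / (1 + A * x' + B * y')) *\<^sub>R P
      + (y / (1 + A * x + B * y) - y' / (1 + A * x' + B * y')) *\<^sub>R R" for x y x' y'
    unfolding chart_def by (simp add: algebra_simps)
  \<comment> \<open>The segment \<open>ab\<close> is the chart line x + y = 1, parametrized by its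
    second coordinate: 0 gives \<open>a\<close> and 1 gives \<open>b\<close>.\<close>
  define T where "T = {s \<in> {0..1}. ?c (1 - s) s \<in> E}"
  \<comment> \<open>In the chart, p and q are the points at infinity of the two axes.\<close>
  have corner: "?c (1 - u) v \<in> E" if u: "u \<in> T" and v: "v \<in> T" and uv: "u < v" for u v
  proof -
    let ?N = "1 + A * (1 - u) + B * v"
    have b: "0 \<le> u" "u \<le> 1" "0 \<le> v" "v \<le> 1" using u v unfolding T_def by auto
    have N: "?N > 0" using chart_denominator_pos[OF AB(1,2) PR] b by simp
    have "?c (1 - u) v \<in> open_segment p (?c (1 - v) v)"
      unfolding p using b uv by (intro chart_in_open_segment_apex AB PR) auto
    moreover have "?c (1 - u) v \<in> open_segment q (?c (1 - u) u)"
      unfolding q chart_swap[of r P R A B] using b uv PR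
      by (intro chart_in_open_segment_apex AB) (auto simp: det2_swap[of P R])
    moreover have "det2 (p - ?c (1 - u) v) (q - ?c (1 - u) v) \<noteq> 0"
    proof -
      have "p - ?c (1 - u) v = (1 / A - (1 - u) / ?N) *\<^sub>R P + (- (v / ?N)) *\<^sub>R R"
        "q - ?c (1 - u) v = (- ((1 - u) / ?N)) *\<^sub>R P + (1 / B - v / ?N) *\<^sub>R R"
        unfolding p q chart_def by (simp_all add: algebra_simps)
      then have "det2 (p - ?c (1 - u) v) (q - ?c (1 - u) v) =
        ((1 / A - (1 - u) / ?N) * (1 / B - v / ?N) - v / ?N * ((1 - u) / ?N)) * det2 P R"
        by (simp only: det2_combination) simp
      \<comment> \<open>Over a common denominator the products of \<open>u\<close> and
        \<open>v\<close> cancel and the numerator collapses to \<open>?N\<close>, so the crossing is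
        transversal.\<close>
      also have "(1 / A - (1 - u) / ?N) * (1 / B - v / ?N) - v / ?N * ((1 - u) / ?N)
          = 1 / (A * B * ?N)"
      proof -
        have e: "1 / A - (1 - u) / ?N = (1 + B * v) / (A * ?N)"
          "1 / B - v / ?N = (1 + A * (1 - u)) / (B * ?N)"
          using AB N by (simp_all add: divide_simps)
        have e2: "v / ?N * ((1 - u) / ?N) = A * (1 - u) * (B * v) / (A * B * (?N * ?N))"
          using AB N by simp
        have frac: "x / (A * n) * (y / (B * n)) - z / (A * B * (n * n)) = (x * y - z) / (A * B * (n * n))"
          for x y z n :: real
          by (simp add: diff_divide_distrib ac_simps)
        have "(1 + B * v) * (1 + A * (1 - u)) - A * (1 - u) * (B * v) = ?N"
          by algebra
        then have "(1 + B * v) / (A * ?N) * ((1 + A * (1 - u)) / (B * ?N)) - A * (1 - u) * (B * v) / (A * B * (?N * ?N))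
          = ?N / (A * B * (?N * ?N))"
          by (simp only: frac)
        also have "\<dots> = 1 / (A * B * ?N)" using AB N by simp
        finally show ?thesis unfolding e e2 .
      qed
      finally show ?thesis using AB N PR by simp
    qed
    ultimately show ?thesis
      using crossing_closedD[OF cc] E u v unfolding T_def by blast
  qed
  have "{0..1} \<subseteq> T"
  proof (rule unit_interval_subset_gapless)
    have "continuous_on {0..1} (\<lambda>s. ?c (1 - s) s)"
      unfolding chart_def using chart_denominator_pos[OF AB PR]
      by (intro continuous_intros) (auto simp: less_imp_neq[symmetric] order.strict_implies_not_eq)
    then have "closed ({0..1} \<inter> (\<lambda>s. ?c (1 - s) s) -` E)"
      using \<open>closed E\<close> by (intro continuous_closed_preimage) auto
    also have "{0..1} \<inter> (\<lambda>s. ?c (1 - s) s) -` E = T" unfolding T_def by auto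
    finally show "closed T" .
    show "0 \<in> T" "1 \<in> T" unfolding T_def using E a b by auto
    fix u v
    assume u: "u \<in> T" and v: "v \<in> T" and uv: "u < v"
    have bd: "0 \<le> u" "u \<le> 1" "0 \<le> v" "v \<le> 1" using u v unfolding T_def by auto
    \<comment> \<open>The chart point (1 - u, v) has coordinate sum 1 + v - u; scaling it by
      \<open>k\<close> moves it along its ray from the origin onto x + y = 1, at second coordinate
      \<open>m\<close>.\<close>
    define k where "k = 1 / (1 + v - u)"
    define m where "m = k * v"
    have k: "0 < k" "k < 1" unfolding k_def using uv by auto
    have m1: "1 - m = k * (1 - u)"
      unfolding m_def k_def using uv by (simp add: field_simps)
    have um: "u < m" "m < v"
    proof -
      have "u * (1 + v - u) < v" using mult_strict_left_mono[OF uv, of "1 - u"] uv bd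
        by (simp add: algebra_simps)
      then show "u < m" unfolding m_def k_def using uv by (simp add: field_simps)
      show "m < v" unfolding m_def using k uv bd by simp
    qed
    have t: "?c (1 - u) v \<in> E" using corner u v uv by blast
    have "?c (1 - m) m \<in> open_segment r (?c (1 - u) v)"
    proof -
      have "?c ((1 - k) * 0 + k * (1 - u)) ((1 - k) * 0 + k * v) \<in> open_segment (?c 0 0) (?c (1 - u) v)"
        using k bd uv by (intro chart_in_open_segment AB PR) auto
      then show ?thesis unfolding m1 by (simp only: m_def r[symmetric] mult_zero_right add_0_left)
    qed
    moreover have "?c (1 - m) m \<in> open_segment (?c (1 - u) u) (?c (1 - v) v)"
    proof -
      define l where "l = (m - u) / (v - u)"
      have l: "0 < l" "l < 1" unfolding l_def using um by auto
      have "m - u = l * (v - u)" unfolding l_def using uv by simp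
      then have "(1 - l) * u + l * v = m" "(1 - l) * (1 - u) + l * (1 - v) = 1 - m"
        by (simp_all add: algebra_simps)
      then show ?thesis
        using chart_in_open_segment[OF AB PR, of "1 - u" u "1 - v" v l r] l bd uv by auto
    qed
    moreover have "det2 (r - ?c (1 - m) m) (?c (1 - u) u - ?c (1 - m) m) \<noteq> 0"
    proof -
      let ?M = "1 + A * (1 - m) + B * m" and ?N = "1 + A * (1 - u) + B * u"
      have MN: "?M > 0" "?N > 0"
        using chart_denominator_pos[OF AB PR] bd um by auto
      have frac: "(- (x / k)) * (y / l) - (- (z / k)) * (w / l) = (z * w - x * y) / (k * l)"
        for x y z w k l :: real
        by (simp add: diff_divide_distrib)
      have e: "r - ?c (1 - m) m = (- ((1 - m) / ?M)) *\<^sub>R P + (- (m / ?M)) *\<^sub>R R"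
        "?c (1 - u) u - r = ((1 - u) / ?N) *\<^sub>R P + (u / ?N) *\<^sub>R R"
        unfolding chart_def by (simp_all add: algebra_simps)
      have "det2 (r - ?c (1 - m) m) (?c (1 - u) u - ?c (1 - m) m) =
        det2 (r - ?c (1 - m) m) (?c (1 - u) u - r)"
        by (simp add: det2_def algebra_simps)
      also have "\<dots> = (m * (1 - u) - (1 - m) * u) / (?M * ?N) * det2 P R"
        unfolding e det2_combination frac ..
      also have "m * (1 - u) - (1 - m) * u = m - u" by (simp add: algebra_simps)
      finally show ?thesis using MN um PR by simp
    qed
    ultimately have "?c (1 - m) m \<in> E"
      using crossing_closedD[OF cc, of "?c (1 - m) m" r "?c (1 - u) v" "?c (1 - u) u" "?c (1 - v) v"]
        E t u v unfolding T_def by blast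
    then have "m \<in> T" unfolding T_def using um bd by auto
    then show "\<exists>z\<in>T. u < z \<and> z < v" using um by blast
  qed
  \<comment> \<open>These are the chart points (1 - u, v) with 0 < u < v < 1 together with others
    excluded by no condition: exactly the corners that \<open>corner\<close> provides for parameters
    \<open>u\<close>, \<open>v\<close>.\<close>
  define W :: "(real \<times> real) set" where "W = {x. fst x < 1} \<inter> {x. snd x < 1} \<inter> {x. 1 < fst x + snd x}"
  have sub: "(\<lambda>(x, y). ?c x y) ` W \<subseteq> E"
  proof clarify
    fix x y assume "(x, y) \<in> W"
    then have "1 - x \<in> T" "y \<in> T" "1 - x < y"
      using \<open>{0..1} \<subseteq> T\<close> unfolding W_def by auto
    from corner[OF this] show "?c x y \<in> E" by simp
  qed
  have "open W"
    unfolding W_def by (intro open_Int open_Collect_less continuous_intros)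
  have nn: "0 < x \<and> 0 < y" if "(x, y) \<in> W" for x y
    using that unfolding W_def by auto
  \<comment> \<open>Invariance of domain: continuity and injectivity of the chart already make the
    image of an open set open.\<close>
  have "open ((\<lambda>(x, y). ?c x y) ` W)"
  proof (rule invariance_of_domain_gen[OF \<open>open W\<close>])
    show "continuous_on W (\<lambda>(x, y). ?c x y)"
      unfolding chart_def case_prod_unfold
    proof (intro continuous_intros ballI)
      fix w assume "w \<in> W"
      then show "1 + A * fst w + B * snd w \<noteq> 0"
        using nn[of "fst w" "snd w"] chart_denominator_pos[OF AB PR, of "fst w" "snd w"] by simp
      then show "1 + A * fst w + B * snd w \<noteq> 0" .
    qed
    show "inj_on (\<lambda>(x, y). ?c x y) W"
      unfolding inj_on_def using chart_eq_iff[OF AB PR] nn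
      by (auto simp: less_imp_le)
  qed simp
  then have "(\<lambda>(x, y). ?c x y) ` W \<subseteq> interior E"
    using sub by (rule interior_maximal[rotated])
  moreover have "(3 / 4, 3 / 4) \<in> W" unfolding W_def by simp
  ultimately show ?thesis by blast
qed

section \<open>Growth of the dense region\<close>

text \<open>Here \<open>p\<close> lies beyond the tangent hyperplane of the ball at
  \<open>b\<close>, so moving \<open>b\<close> away from \<open>p\<close> enters the ball. The
  squared distance to \<open>c\<close> changes by \<open>- e * (2 * ?k - e * ?n)\<close>, which is
  negative for 0 < e < 2 * ?k / ?n.\<close>

lemma ball_slides_outward:
  fixes b c p :: "'a::euclidean_space"
  assumes "dist c b = r" "(b - c) \<bullet> (p - b) > 0"
  shows "\<exists>e0>0. \<forall>e. 0 < e \<and> e < e0 \<longrightarrow> b + e *\<^sub>R (b - p) \<in> ball c r"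
proof -
  let ?k = "(b - c) \<bullet> (p - b)" and ?n = "(p - b) \<bullet> (p - b)"
  have n: "?n > 0" using assms(2) by (metis inner_gt_zero_iff inner_zero_right less_irrefl)
  have "b + e *\<^sub>R (b - p) \<in> ball c r" if e: "0 < e" "e < 2 * ?k / ?n" for e
  proof -
    have "(b + e *\<^sub>R (b - p) - c) \<bullet> (b + e *\<^sub>R (b - p) - c)
        = (b - c) \<bullet> (b - c) - e * (2 * ?k - e * ?n)"
      by (simp add: algebra_simps inner_commute power2_eq_square)
    moreover have "e * ?n < 2 * ?k" using e n by (simp add: field_simps)
    ultimately have "(b + e *\<^sub>R (b - p) - c) \<bullet> (b + e *\<^sub>R (b - p) - c) < (b - c) \<bullet> (b - c)"
      using e by simp
    then have "norm (b + e *\<^sub>R (b - p) - c) < norm (b - c)"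
      by (simp add: norm_lt)
    then show ?thesis using assms(1) by (simp add: dist_norm norm_minus_commute)
  qed
  then show ?thesis
    using n assms(2) by (intro exI[of _ "2 * ?k / ?n"]) auto
qed

text \<open>For \<open>z\<close> near \<open>b\<close>, prolonging the segments from
  \<open>p\<close> and from \<open>q\<close> through \<open>z\<close> by a small fixed factor ends
  in the ball. Hence \<open>z\<close> is a crossing of two segments with endpoints in
  \<open>E\<close>.\<close>

lemma boundary_point_interior:
  assumes "closed E" and cc: "crossing_closed E"
    and ball: "ball c r \<subseteq> E" and b: "dist c b = r"
    and E: "p \<in> E" "q \<in> E" "p \<noteq> q"
    and beyond: "(b - c) \<bullet> (p - b) > 0" "(b - c) \<bullet> (q - b) > 0"
  shows "b \<in> interior E"
proof -
  obtain e1 e2 where "e1 > 0" "e2 > 0"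
    and e1: "\<And>e. 0 < e \<Longrightarrow> e < e1 \<Longrightarrow> b + e *\<^sub>R (b - p) \<in> ball c r"
    and e2: "\<And>e. 0 < e \<Longrightarrow> e < e2 \<Longrightarrow> b + e *\<^sub>R (b - q) \<in> ball c r"
    using ball_slides_outward[OF b beyond(1)] ball_slides_outward[OF b beyond(2)] by blast
  define e where "e = min e1 e2 / 2"
  have e: "0 < e" "e < e1" "e < e2"
    using \<open>e1 > 0\<close> \<open>e2 > 0\<close> unfolding e_def by auto
  define N where "N = (\<lambda>z. z + e *\<^sub>R (z - p)) -` ball c r \<inter> (\<lambda>z. z + e *\<^sub>R (z - q)) -` ball c r"
  have "open N"
    unfolding N_def by (intro open_Int continuous_open_vimage open_ball) (auto intro!: continuous_intros)
  have "b \<in> N" unfolding N_def using e1 e2 e by auto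
  \<comment> \<open>On the line \<open>pq\<close> the two segments are not transversal. A line has
    empty interior, though, so the open set \<open>N - E\<close>, which it contains, must be
    empty.\<close>
  define H where "H = {z. rot (q - p) \<bullet> z = rot (q - p) \<bullet> p}"
  have "z \<in> E" if z: "z \<in> N" "z \<notin> H" for z
  proof -
    have det: "det2 (p - z) (q - z) \<noteq> 0"
      using z(2) unfolding H_def inner_rot by (simp add: det2_def algebra_simps)
    have seg: "z \<in> open_segment x (z + e *\<^sub>R (z - x))" if "x \<noteq> z" for x
    proof -
      have "z = (1 - 1 / (1 + e)) *\<^sub>R x + (1 / (1 + e)) *\<^sub>R (z + e *\<^sub>R (z - x))"
      proof -
        have "(1 / (1 + e)) *\<^sub>R (z + e *\<^sub>R (z - x)) = (1 / (1 + e)) *\<^sub>R ((1 + e) *\<^sub>R z - e *\<^sub>R x)"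
          by (simp add: algebra_simps)
        also have "\<dots> = z - (e / (1 + e)) *\<^sub>R x" using e by (simp add: scaleR_diff_right)
        also have "e / (1 + e) = 1 - 1 / (1 + e)" using e by (simp add: field_simps)
        finally show ?thesis by simp
      qed
      moreover have "x \<noteq> z + e *\<^sub>R (z - x)"
      proof
        assume "x = z + e *\<^sub>R (z - x)"
        then have "(1 + e) *\<^sub>R (z - x) = 0" by (simp add: algebra_simps)
        then show False using e that by simp
      qed
      ultimately show ?thesis
        unfolding in_segment using e by (intro conjI exI[of _ "1 / (1 + e)"]) auto
    qed
    have "p \<noteq> z" "q \<noteq> z" using det by auto
    then show ?thesis
      using crossing_closedD[OF cc seg seg, of p q] det E z(1) ball unfolding N_def by blast
  qed
  then have "N \<inter> - E \<subseteq> interior H"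
    using \<open>open N\<close> \<open>closed E\<close> by (intro interior_maximal open_Int) auto
  also have "interior H = {}"
    unfolding H_def using E(3) by (intro interior_hyperplane) simp
  finally have "N \<subseteq> E" by blast
  then show ?thesis using \<open>open N\<close> \<open>b \<in> N\<close> interior_maximal by blast
qed

section \<open>The candidate region and growth inside it\<close>

lemma half_plane_closed_convex:
  assumes "closed_half_plane H"
  shows "closed H" "convex H"
  using assms unfolding closed_half_plane_def
  by (auto simp: closed_halfspace_le convex_halfspace_le)

lemma closed_candidate: "closed (candidate S)"
  unfolding candidate_def by (intro closed_INT ballI closed_Inter) (auto dest: half_plane_closed_convex)

lemma convex_candidate: "convex (candidate S)"
  unfolding candidate_def by (intro convex_INT convex_Inter) (auto dest: half_plane_closed_convex)

text \<open>If at most one point \<open>p\<close> of \<open>S\<close> lay strictly beyond the line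
  through \<open>z\<close> with normal \<open>n\<close>, the opposite closed half plane would
  contain \<open>S - {p}\<close> and hence the candidate. Then \<open>z\<close>, being on its
  boundary, could not be interior to the candidate.\<close>

lemma two_points_beyond_interior:
  assumes "S \<noteq> {}" and z: "z \<in> interior (candidate S)" and n: "n \<noteq> 0"
  obtains p q where "p \<in> S" "q \<in> S" "p \<noteq> q" "n \<bullet> (p - z) > 0" "n \<bullet> (q - z) > 0"
proof -
  have "\<exists>p\<in>S. \<exists>q\<in>S. p \<noteq> q \<and> n \<bullet> (p - z) > 0 \<and> n \<bullet> (q - z) > 0"
  proof (rule ccontr)
    assume neg: "\<not> ?thesis"
    have "\<exists>p\<in>S. S - {p} \<subseteq> {x. n \<bullet> x \<le> n \<bullet> z}"
    proof (cases "\<exists>p\<in>S. n \<bullet> (p - z) > 0")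
      case True
      then obtain p where p: "p \<in> S" "n \<bullet> (p - z) > 0" by blast
      have "n \<bullet> x \<le> n \<bullet> z" if "x \<in> S - {p}" for x
      proof -
        have "\<not> n \<bullet> (x - z) > 0" using neg p that by blast
        then show ?thesis by (simp add: inner_diff_right)
      qed
      then show ?thesis using p(1) by blast
    next
      case False
      have "n \<bullet> x \<le> n \<bullet> z" if "x \<in> S" for x
      proof -
        have "\<not> n \<bullet> (x - z) > 0" using False that by blast
        then show ?thesis by (simp add: inner_diff_right)
      qed
      then show ?thesis using \<open>S \<noteq> {}\<close> by blast
    qed
    moreover have "closed_half_plane {x. n \<bullet> x \<le> n \<bullet> z}"
      unfolding closed_half_plane_def using n by blast
    ultimately have "candidate S \<subseteq> {x. n \<bullet> x \<le> n \<bullet> z}"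
      unfolding candidate_def by blast
    then have "z \<in> interior {x. n \<bullet> x \<le> n \<bullet> z}"
      using z interior_mono by blast
    then show False using n by simp
  qed
  then show ?thesis using that by blast
qed

text \<open>Otherwise, by connectedness, the interior of \<open>E\<close> has a frontier point
  inside the interior of the candidate. A ball in \<open>E\<close> that touches a boundary point
  \<open>b\<close> near it, and two points of \<open>S\<close> beyond the tangent at
  \<open>b\<close>, make \<open>b\<close> interior to \<open>E\<close> after all.\<close>

lemma interior_candidate_subset:
  assumes "closed E" and cc: "crossing_closed E" and "S \<subseteq> E" "S \<noteq> {}"
    and ne: "interior E \<inter> interior (candidate S) \<noteq> {}"
  shows "interior (candidate S) \<subseteq> E"
proof (rule ccontr)
  let ?K = "interior (candidate S)" and ?W = "interior E"
  assume "\<not> ?K \<subseteq> E"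
  then have "?K - ?W \<noteq> {}" using interior_subset by blast
  moreover have "connected ?K"
    by (intro convex_connected convex_interior convex_candidate)
  ultimately obtain f where f: "f \<in> ?K" "f \<in> frontier ?W"
    using connected_Int_frontier[of ?K ?W] ne by blast
  obtain d where d: "d > 0" "ball f d \<subseteq> ?K"
    using f(1) by (meson open_contains_ball open_interior)
  have "f \<in> closure ?W" using f(2) by (simp add: frontier_def)
  \<comment> \<open>Half the radius: the point \<open>b\<close> outside \<open>?W\<close> nearest to
    \<open>g\<close> is no farther from \<open>g\<close> than \<open>f\<close> is, so it stays in
    \<open>ball f d\<close>.\<close>
  then obtain g where g: "g \<in> ?W" "dist g f < d / 2"
    using d(1) by (metis closure_approachable half_gt_zero)
  have "f \<notin> ?W" using f(2) by (simp add: frontier_def)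
  then obtain b where b: "b \<notin> ?W" and bmin: "\<And>y. y \<notin> ?W \<Longrightarrow> dist g b \<le> dist g y"
    using distance_attains_inf[of "- ?W" g] by auto
  have "ball g (dist g b) \<subseteq> E"
    using bmin interior_subset[of E] by (force simp: subset_iff)
  have "b \<in> ball f d"
    using bmin[OF \<open>f \<notin> ?W\<close>] g(2) dist_triangle[of f b g] by (simp add: dist_commute)
  then have "b \<in> ?K" using d(2) by blast
  moreover have "b - g \<noteq> 0" using b g(1) by auto
  ultimately obtain p q where "p \<in> S" "q \<in> S" "p \<noteq> q" "(b - g) \<bullet> (p - b) > 0" "(b - g) \<bullet> (q - b) > 0"
    using two_points_beyond_interior[OF \<open>S \<noteq> {}\<close>] by metis
  then have "b \<in> ?W"
    using boundary_point_interior[OF \<open>closed E\<close> cc \<open>ball g (dist g b) \<subseteq> E\<close> refl] \<open>S \<subseteq> E\<close> by blast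
  then show False using b by blast
qed

section \<open>The stages of the iteration and their closure\<close>

lemma iterated_subset: "iterated S i \<subseteq> S \<union> candidate S"
proof (induction S i rule: iterated.induct)
  case (3 S i)
  show ?case
  proof
    fix x assume "x \<in> iterated S (Suc (Suc i))"
    then obtain a b c d where mem: "a \<in> S \<union> candidate S" "b \<in> S \<union> candidate S"
      "c \<in> S \<union> candidate S" "d \<in> S \<union> candidate S"
      and x: "{x} = closed_segment a b \<inter> closed_segment c d"
      using 3 unfolding iterated.simps crossings_def segments_def by blast
    have "x \<in> H" if "x \<notin> S" "p \<in> S" "closed_half_plane H" "S - {p} \<subseteq> H" for p H
    proof -
      have KH: "candidate S \<subseteq> H" using that unfolding candidate_def by blast
      have seg: "x \<in> H" if "x \<in> closed_segment u v" "u \<in> H" "v \<in> H" for u v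
        using closed_segment_subset[OF that(2,3)] half_plane_closed_convex(2)[OF \<open>closed_half_plane H\<close>] that(1) by blast
      \<comment> \<open>The only common point of the two segments is \<open>x\<close>, which is not
        in \<open>S\<close>, so \<open>p\<close> cannot be an endpoint of both. A segment without
        endpoint \<open>p\<close> has both ends, and thus also \<open>x\<close>, in
        \<open>H\<close>.\<close>
      have "p \<notin> closed_segment a b \<inter> closed_segment c d"
        using x that by (metis singletonD)
      then have "(a \<noteq> p \<and> b \<noteq> p) \<or> (c \<noteq> p \<and> d \<noteq> p)" by auto
      then show ?thesis
        using seg x mem KH that(4) by blast
    qed
    then show "x \<in> S \<union> candidate S" unfolding candidate_def by blast
  qed
qed auto

lemma iterated_limit_subset: "iterated_limit S \<subseteq> S \<union> candidate S"
  unfolding iterated_limit_def using iterated_subset by blast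

lemma subset_iterated_limit: "S \<subseteq> iterated_limit S"
proof
  fix x assume "x \<in> S"
  then have "x \<in> iterated S 1" by simp
  then show "x \<in> iterated_limit S" unfolding iterated_limit_def by blast
qed

lemma crossing_closed_iterated_limit: "crossing_closed (iterated_limit S)"
  unfolding crossing_closed_def
proof (intro ballI allI impI)
  fix a b c d z
  assume "a \<in> iterated_limit S" "b \<in> iterated_limit S" "c \<in> iterated_limit S" "d \<in> iterated_limit S"
    and zab: "z \<in> open_segment a b" and zcd: "z \<in> open_segment c d" and det: "det2 (a - z) (c - z) \<noteq> 0"
  then obtain i j k l where ijkl: "a \<in> iterated S i" "b \<in> iterated S j" "c \<in> iterated S k" "d \<in> iterated S l"
    "1 \<le> i" "1 \<le> j" "1 \<le> k" "1 \<le> l"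
    unfolding iterated_limit_def by auto
  \<comment> \<open>A stage beyond all four; the crossing is then formed one stage after
    \<open>Suc m\<close>.\<close>
  define m where "m = i + j + k + l"
  let ?U = "\<Union>j\<in>{1..Suc m}. iterated S j"
  have U: "a \<in> ?U" "b \<in> ?U" "c \<in> ?U" "d \<in> ?U"
    using ijkl unfolding m_def by (auto intro: bexI[of _ i] bexI[of _ j] bexI[of _ k] bexI[of _ l])
  \<comment> \<open>The difference of two common points is parallel to both segments, and
    transversality forces it to be 0.\<close>
  have "{z} = closed_segment a b \<inter> closed_segment c d"
  proof
    show "{z} \<subseteq> closed_segment a b \<inter> closed_segment c d"
      using zab zcd by (auto simp: open_segment_def)
    show "closed_segment a b \<inter> closed_segment c d \<subseteq> {z}"
    proof
      fix w assume w: "w \<in> closed_segment a b \<inter> closed_segment c d"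
      have on_line: "det2 (y - x) (w - z) = 0" if wz: "w \<in> closed_segment x y" "z \<in> open_segment x y" for x y
      proof -
        obtain s where w1: "w = (1 - s) *\<^sub>R x + s *\<^sub>R y"
          using wz(1) unfolding in_segment by blast
        obtain t where z1: "z = (1 - t) *\<^sub>R x + t *\<^sub>R y"
          using wz(2) unfolding in_segment by blast
        have "w - z = (s - t) *\<^sub>R (y - x)" unfolding w1 z1 by (simp add: algebra_simps)
        then show ?thesis by (simp add: det2_scaleR_right)
      qed
      have dir: "\<exists>k. x - z = k *\<^sub>R (y - x)" if z: "z \<in> open_segment x y" for x y
      proof -
        obtain t where "z = x + t *\<^sub>R (y - x)" using z unfolding in_open_segment_iff by blast
        then have "x - z = (- t) *\<^sub>R (y - x)" by simp
        then show ?thesis by blast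
      qed
      have "det2 (a - z) (w - z) = 0" "det2 (c - z) (w - z) = 0"
        using on_line dir[OF zab] dir[OF zcd] w zab zcd by (auto simp: det2_scaleR_left)
      then have "w - z = 0"
        using det2_basis[OF det, of "w - z"] by (simp add: det2_swap[of "w - z"])
      then show "w \<in> {z}" by simp
    qed
  qed
  moreover have "a \<noteq> b" "c \<noteq> d" using zab zcd by auto
  ultimately have "z \<in> iterated S (Suc (Suc m))"
    unfolding iterated.simps crossings_def segments_def using U by blast
  then show "z \<in> iterated_limit S"
    unfolding iterated_limit_def by (intro UN_I[of "Suc (Suc m)"]) simp_all
qed

lemma cut_triangle_dense:
  assumes "finite S" and "cut_triangle (closure (iterated_limit S))"
  shows "dense_in (iterated_limit S) (candidate S)"
proof -
  define X where "X = iterated_limit S"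
  let ?E = "closure X" and ?K = "candidate S"
  have E: "closed ?E" "crossing_closed ?E"
    unfolding X_def by (simp_all add: crossing_closed_closure crossing_closed_iterated_limit)
  have "S \<subseteq> ?E" unfolding X_def using subset_iterated_limit closure_subset by blast
  \<comment> \<open>For empty \<open>S\<close> the candidate is the empty intersection, that is, the
    whole plane; the cut triangle rules this case out.\<close>
  have "S \<noteq> {}"
  proof
    assume "S = {}"
    have "iterated S i = {}" if "S = {}" for S i
      using that by (induction S i rule: iterated.induct) (auto simp: crossings_def segments_def)
    with \<open>S = {}\<close> have "iterated S i = {}" for i by simp
    then have "X = {}" unfolding X_def iterated_limit_def by auto
    then show False using assms(2) unfolding X_def cut_triangle_def by auto
  qed
  have "?E \<subseteq> S \<union> ?K"
    unfolding X_def using assms(1) by (intro closure_minimal iterated_limit_subset closed_Un closed_candidate finite_imp_closed)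
  \<comment> \<open>Removing the finite set \<open>S\<close> leaves an open set inside the
    candidate. It is nonempty because a nonempty open set in the plane is infinite.\<close>
  then have "interior ?E - S \<subseteq> interior ?K"
    using interior_subset[of ?E] by (intro interior_maximal open_Diff finite_imp_closed assms(1)) auto
  moreover have "infinite (interior ?E)"
    using cut_triangle_interior[OF E] assms(2) empty_interior_finite[of "interior ?E"] unfolding X_def by auto
  then have "interior ?E - S \<noteq> {}" using assms(1) by (metis Diff_eq_empty_iff finite_subset)
  ultimately have ne: "interior ?E \<inter> interior ?K \<noteq> {}" by blast
  have "interior ?K \<subseteq> ?E"
    using interior_candidate_subset[OF E \<open>S \<subseteq> ?E\<close> \<open>S \<noteq> {}\<close> ne] .
  then have "interior ?K \<subseteq> interior ?K \<inter> closure X" by blast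
  also have "\<dots> \<subseteq> closure (interior ?K \<inter> X)" by (intro open_Int_closure_subset open_interior)
  also have "\<dots> \<subseteq> closure (X \<inter> ?K)"
    using interior_subset by (intro closure_mono) blast
  finally have "closure (interior ?K) \<subseteq> closure (X \<inter> ?K)" by (simp add: closure_minimal)
  \<comment> \<open>A closed convex set with nonempty interior is the closure of its interior, so
    density inside is enough.\<close>
  moreover have "closure (interior ?K) = ?K"
    using convex_closure_interior[OF convex_candidate] ne closed_candidate by (metis Int_empty_right closure_closed)
  ultimately show ?thesis unfolding dense_in_def X_def by simp
qed

section \<open>Crossing segments\<close>

text \<open>The form of betweenness used when \<open>z\<close> serves as origin: the two ends lie on
  opposite rays.\<close>

lemma in_open_segment_iff_opposite:
  fixes z :: "'a::real_vector"
  shows "z \<in> open_segment a b \<longleftrightarrow> a \<noteq> z \<and> (\<exists>k>0. b = z - k *\<^sub>R (a - z))"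
proof
  assume "z \<in> open_segment a b"
  then obtain s where s: "a \<noteq> b" "0 < s" "s < 1" "z = a + s *\<^sub>R (b - a)"
    unfolding in_open_segment_iff by blast
  have "b - z = (1 - s) *\<^sub>R (b - a)" unfolding s(4) by (simp add: algebra_simps)
  moreover have az: "a - z = (- s) *\<^sub>R (b - a)" unfolding s(4) by simp
  ultimately have "b - z = - (((1 - s) / s) *\<^sub>R (a - z))"
    unfolding az using s(2) by simp
  then have "b = z - ((1 - s) / s) *\<^sub>R (a - z)" by (simp add: diff_eq_eq)
  moreover have "(1 - s) / s > 0" using s by simp
  moreover have "a \<noteq> z" using az s by auto
  ultimately show "a \<noteq> z \<and> (\<exists>k>0. b = z - k *\<^sub>R (a - z))" by blast
next
  assume "a \<noteq> z \<and> (\<exists>k>0. b = z - k *\<^sub>R (a - z))"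
  then obtain k where k: "a \<noteq> z" "k > 0" "b = z - k *\<^sub>R (a - z)" by blast
  have ba: "b - a = - ((1 + k) *\<^sub>R (a - z))" unfolding k(3) by (simp add: algebra_simps)
  have "z = a + (1 / (1 + k)) *\<^sub>R (b - a)" unfolding ba using k(2) by simp
  moreover have "0 < 1 / (1 + k)" "1 / (1 + k) < 1" using k(2) by auto
  moreover have "a \<noteq> b" using ba k by auto
  ultimately show "z \<in> open_segment a b" unfolding in_open_segment_iff by blast
qed

lemma cut_triangleI:
  "r \<in> E \<Longrightarrow> p \<in> E \<Longrightarrow> q \<in> E \<Longrightarrow> a \<in> E \<Longrightarrow> b \<in> E \<Longrightarrow> det2 (p - r) (q - r) \<noteq> 0 \<Longrightarrow>
   a \<in> open_segment r p \<Longrightarrow> b \<in> open_segment r q \<Longrightarrow> cut_triangle E"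
  unfolding cut_triangle_def by blast

lemma det2_eq_0_imp_parallel:
  assumes "u \<noteq> 0" "det2 u v = 0"
  obtains h where "v = h *\<^sub>R u"
proof -
  have "collinear {0, u, v}" using assms by (simp add: collinear_iff_det2)
  then show ?thesis using that assms(1) unfolding collinear_lemma by (metis scaleR_zero_left)
qed

text \<open>Coordinates (u,v) of \<open>x\<close> refer to the origin \<open>o'\<close> and the unit
  points \<open>a\<close> and \<open>c\<close>. If u + v > 1, then \<open>o'x\<close> crosses
  \<open>ac\<close> in \<open>e\<close>, and the triangle \<open>a c b\<close> is cut by
  \<open>e\<close> and \<open>o'\<close>. If u + v = 1, \<open>x\<close> takes the place of
  \<open>e\<close>. If u + v < 1, then \<open>bx\<close> crosses \<open>o'c\<close> in
  \<open>f\<close>, and the triangle \<open>b x a\<close> is cut by \<open>f\<close> and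
  \<open>o'\<close>.\<close>

lemma cut_triangle_of_quadrant:
  assumes cc: "crossing_closed E"
    and mem: "o' \<in> E" "a \<in> E" "b \<in> E" "c \<in> E" "x \<in> E"
    and oab: "o' \<in> open_segment a b" and det: "det2 (a - o') (c - o') \<noteq> 0"
    and x: "x = o' + u *\<^sub>R (a - o') + v *\<^sub>R (c - o')" and uv: "u > 0" "v > 0"
  shows "cut_triangle E"
proof -
  define P where "P = a - o'"
  define R where "R = c - o'"
  have PR: "det2 P R \<noteq> 0" unfolding P_def R_def by (fact det)
  obtain k where k: "k > 0" "b = o' - k *\<^sub>R (a - o')"
    using oab unfolding in_open_segment_iff_opposite by blast
  have a: "a = o' + P" and c: "c = o' + R" and b: "b = o' - k *\<^sub>R P"
    and x': "x = o' + u *\<^sub>R P + v *\<^sub>R R"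
    unfolding P_def R_def using k x by simp_all
  have comb: "det2 w w' \<noteq> 0" if "w = m *\<^sub>R P + n *\<^sub>R R" "w' = m' *\<^sub>R P + n' *\<^sub>R R" "m * n' - n * m' \<noteq> 0"
    for w w' m n m' n'
    using that PR by (simp add: det2_combination)
  have neq: "a \<noteq> c" using comb[of "a - c" 1 "-1" "P" 1 0] unfolding a c by auto
  have cab: "det2 (c - a) (b - a) \<noteq> 0"
    by (rule comb[of _ "- 1" 1 _ "- (1 + k)" 0]) (use k in \<open>auto simp: a b c algebra_simps\<close>)
  have ba: "o' \<in> open_segment b a" using oab by (simp add: open_segment_commute)
  consider "u + v > 1" | "u + v = 1" | "u + v < 1" by linarith
  then show ?thesis
  proof cases
    case 1
    define s where "s = u + v"
    have s: "s > 1" "s \<noteq> 0" using 1 unfolding s_def by auto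
    define e where "e = o' + (1 / s) *\<^sub>R (u *\<^sub>R P + v *\<^sub>R R)"
    have us: "u / s + v / s = 1" using s by (simp add: s_def flip: add_divide_distrib)
    have "a - e = (u / s + v / s) *\<^sub>R P - (u / s) *\<^sub>R P - (v / s) *\<^sub>R R"
      unfolding us e_def a by (simp add: algebra_simps)
    then have ae: "a - e = (v / s) *\<^sub>R P - (v / s) *\<^sub>R R"
      by (simp add: scaleR_add_left)
    have "c - e = (u / s + v / s) *\<^sub>R R - (u / s) *\<^sub>R P - (v / s) *\<^sub>R R"
      unfolding us e_def c by (simp add: algebra_simps)
    then have ce: "c - e = (u / s) *\<^sub>R R - (u / s) *\<^sub>R P"
      by (simp add: scaleR_add_left)
    have oe: "o' - e = (- (u / s)) *\<^sub>R P + (- (v / s)) *\<^sub>R R"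
      unfolding e_def by (simp add: algebra_simps)
    have d: "det2 (o' - e) (a - e) \<noteq> 0"
    proof (rule comb[OF oe])
      show "a - e = (v / s) *\<^sub>R P + (- (v / s)) *\<^sub>R R" using ae by simp
      have "- (u / s) * - (v / s) - - (v / s) * (v / s) = (v / s) * ((u + v) / s)"
        by (simp add: algebra_simps add_divide_distrib)
      then show "- (u / s) * - (v / s) - - (v / s) * (v / s) \<noteq> 0" using uv s by (simp add: s_def)
    qed
    have "e \<in> open_segment o' x"
      unfolding in_open_segment_iff_opposite
    proof (intro conjI exI[of _ "s - 1"])
      show "o' \<noteq> e" using d by auto
      have "o' - e = - ((1 / s) *\<^sub>R (u *\<^sub>R P + v *\<^sub>R R))" unfolding e_def by simp
      then have "e - (s - 1) *\<^sub>R (o' - e) = o' + (1 / s + (s - 1) * (1 / s)) *\<^sub>R (u *\<^sub>R P + v *\<^sub>R R)"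
        by (simp add: e_def scaleR_add_left)
      also have "1 / s + (s - 1) * (1 / s) = 1" using s by (simp add: field_simps)
      finally show "x = e - (s - 1) *\<^sub>R (o' - e)" unfolding x' by (simp add: add.assoc)
    qed (use s in auto)
    moreover have eac: "e \<in> open_segment a c"
      unfolding in_open_segment_iff_opposite
    proof (intro conjI exI[of _ "u / v"])
      show "a \<noteq> e" using d by auto
      have "(u / v) *\<^sub>R (a - e) = (u / s) *\<^sub>R P - (u / s) *\<^sub>R R"
        unfolding ae using uv by (simp add: scaleR_diff_right)
      then have "c - e = - ((u / v) *\<^sub>R (a - e))" using ce by simp
      then show "c = e - (u / v) *\<^sub>R (a - e)" by (simp add: diff_eq_eq)
    qed (use uv in auto)
    ultimately have "e \<in> E" using crossing_closedD[OF cc _ _ mem(1,5,2,4) d] by blast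
    then show ?thesis using cut_triangleI[OF mem(2,4,3) _ mem(1) cab eac oab] by blast
  next
    case 2
    have "x \<in> open_segment a c"
      unfolding in_open_segment_iff using neq uv 2
      by (intro conjI exI[of _ v]) (auto simp: x' a c algebra_simps simp flip: scaleR_add_left)
    then show ?thesis using cut_triangleI[OF mem(2,4,3,5,1) cab _ oab] by blast
  next
    case 3
    \<comment> \<open>The height at which the line from \<open>b = (-k, 0)\<close> to
      \<open>x = (u, v)\<close> meets the axis through \<open>c\<close>.\<close>
    define y where "y = v * (k / (u + k))"
    have y: "y > 0" unfolding y_def using uv k by simp
    have "k / (u + k) < 1" using uv k by simp
    then have "y < v" unfolding y_def using uv(2) mult_strict_left_mono[of "k / (u + k)" 1 v] by simp
    then have y1: "y < 1" using 3 uv by simp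
    define f where "f = o' + y *\<^sub>R R"
    have d: "det2 (b - f) (o' - f) \<noteq> 0"
      by (rule comb[of _ "- k" "- y" _ 0 "- y"]) (use k y in \<open>auto simp: b f_def algebra_simps\<close>)
    have "f \<in> open_segment b x"
      unfolding in_open_segment_iff_opposite
    proof (intro conjI exI[of _ "u / k"])
      show "b \<noteq> f" using d by auto
      have "b - f = (- k) *\<^sub>R P + (- y) *\<^sub>R R" unfolding b f_def by (simp add: algebra_simps)
      then have "(u / k) *\<^sub>R (b - f) = (- u) *\<^sub>R P - (u / k * y) *\<^sub>R R"
        using k by (simp only: scaleR_add_right scaleR_scaleR) simp
      then have "f - (u / k) *\<^sub>R (b - f) = o' + u *\<^sub>R P + (y + u / k * y) *\<^sub>R R"
        unfolding f_def by (simp only:) (simp add: algebra_simps)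
      also have "y + u / k * y = v" unfolding y_def using uv k by (simp add: divide_simps) (simp add: algebra_simps)
      finally show "x = f - (u / k) *\<^sub>R (b - f)" unfolding x' ..
    qed (use uv k in auto)
    note fbx = this
    have "f \<in> open_segment o' c"
      unfolding in_open_segment_iff using PR y y1
      by (auto simp: c f_def intro!: exI[of _ y])
    then have "f \<in> E" using crossing_closedD[OF cc fbx _ mem(3,5,1,4) d] by blast
    moreover have "det2 (x - b) (a - b) \<noteq> 0"
    proof (rule comb)
      show "x - b = (u + k) *\<^sub>R P + v *\<^sub>R R" "a - b = (1 + k) *\<^sub>R P + 0 *\<^sub>R R"
        unfolding a b x' by (simp_all add: algebra_simps)
      show "(u + k) * 0 - v * (1 + k) \<noteq> 0" using k uv by simp
    qed
    ultimately show ?thesis using cut_triangleI[OF mem(3,5,2) _ mem(1) _ fbx ba] by blast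
  qed
qed

text \<open>Since \<open>c\<close> and \<open>x\<close> lie strictly on one side of
  \<open>ab\<close> and on different rays from \<open>o'\<close>, the coordinates of
  \<open>x\<close> satisfy v > 0 and u \<noteq> 0. For u < 0, exchanging \<open>a\<close> and
  \<open>b\<close> brings \<open>x\<close> into the quadrant.\<close>

lemma cut_triangle_of_same_side:
  assumes cc: "crossing_closed E"
    and mem: "o' \<in> E" "a \<in> E" "b \<in> E" "c \<in> E" "x \<in> E"
    and oab: "o' \<in> open_segment a b"
    and side: "det2 (a - o') (c - o') * det2 (a - o') (x - o') > 0"
    and ncol: "det2 (c - o') (x - o') \<noteq> 0"
  shows "cut_triangle E"
proof -
  have det: "det2 (a - o') (c - o') \<noteq> 0" using side by auto
  define u where "u = det2 (x - o') (c - o') / det2 (a - o') (c - o')"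
  define v where "v = det2 (a - o') (x - o') / det2 (a - o') (c - o')"
  have "x - o' = u *\<^sub>R (a - o') + v *\<^sub>R (c - o')"
    unfolding u_def v_def by (rule det2_basis[OF det])
  then have x: "x = o' + u *\<^sub>R (a - o') + v *\<^sub>R (c - o')" by (simp add: algebra_simps)
  have "v > 0" unfolding v_def using side by (simp add: zero_less_divide_iff zero_less_mult_iff) blast
  have "u \<noteq> 0" unfolding u_def using det ncol by (simp add: det2_swap[of "x - o'"])
  show ?thesis
  proof (cases "u > 0")
    case True
    then show ?thesis using cut_triangle_of_quadrant[OF cc mem oab det x _ \<open>v > 0\<close>] by blast
  next
    case False
    obtain k where k: "k > 0" "b = o' - k *\<^sub>R (a - o')"
      using oab unfolding in_open_segment_iff_opposite by blast
    have bo: "b - o' = (- k) *\<^sub>R (a - o')" using k by simp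
    have "det2 (b - o') (c - o') \<noteq> 0"
      unfolding bo det2_scaleR_left using k det by simp
    moreover have "x = o' + (- u / k) *\<^sub>R (b - o') + v *\<^sub>R (c - o')"
      unfolding bo using x k by simp
    moreover have "- u / k > 0" using False \<open>u \<noteq> 0\<close> k by (simp add: field_simps)
    moreover have "o' \<in> open_segment b a" using oab by (simp add: open_segment_commute)
    ultimately show ?thesis
      using cut_triangle_of_quadrant[OF cc mem(1,3,2,4,5)] \<open>v > 0\<close> by blast
  qed
qed

text \<open>The line has direction \<open>w\<close> and passes through \<open>o'\<close>. As
  \<open>o'\<close> lies between \<open>c\<close> and \<open>d\<close>, these are on opposite sides;
  which of them is on the negative side decides their order in case (iii).\<close>

lemma separating_lineI:
  assumes "c \<in> S" "d \<in> S" "o' \<in> open_segment c d" "det2 w (c - o') \<noteq> 0"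
    and line: "\<And>x. x \<in> S \<Longrightarrow> x \<noteq> c \<Longrightarrow> x \<noteq> d \<Longrightarrow> det2 w (x - o') = 0"
  shows "all_but_two_on_separating_line S"
proof -
  obtain k where k: "k > 0" "d = o' - k *\<^sub>R (c - o')"
    using assms(3) unfolding in_open_segment_iff_opposite by blast
  have "det2 w (d - o') = - k * det2 w (c - o')"
    unfolding k(2) by (simp add: det2_minus_right det2_scaleR_right)
  then have opp: "det2 w (c - o') < 0 \<and> det2 w (d - o') > 0 \<or> det2 w (d - o') < 0 \<and> det2 w (c - o') > 0"
    using k assms(4) by (auto simp: mult_less_0_iff zero_less_mult_iff not_less order.order_iff_strict)
  have w: "rot w \<noteq> 0" using assms(4) by auto
  have sub: "S - {c, d} \<subseteq> {x. rot w \<bullet> x = rot w \<bullet> o'}"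
    using line by (auto simp: inner_rot det2_diff_right)
  from opp show ?thesis
  proof
    assume "det2 w (c - o') < 0 \<and> det2 w (d - o') > 0"
    then show ?thesis unfolding all_but_two_on_separating_line_def
      using assms(1,2) w sub
      by (intro bexI[of _ c] bexI[of _ d] exI[of _ "rot w"] exI[of _ "rot w \<bullet> o'"])
        (auto simp: inner_rot det2_diff_right)
  next
    assume "det2 w (d - o') < 0 \<and> det2 w (c - o') > 0"
    then show ?thesis unfolding all_but_two_on_separating_line_def
      using assms(1,2) w sub
      by (intro bexI[of _ d] bexI[of _ c] exI[of _ "rot w"] exI[of _ "rot w \<bullet> o'"])
        (auto simp: inner_rot det2_diff_right)
  qed
qed

text \<open>Of two distinct points on a ray from \<open>o'\<close>, one lies between
  \<open>o'\<close> and the other. Such a pair is one cut side of a triangle with apex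
  \<open>o'\<close>.\<close>

lemma nested_on_ray:
  fixes o' :: "'a::real_vector"
  assumes "a \<noteq> o'" "x = o' + h *\<^sub>R (a - o')" "h > 0" "x \<noteq> a"
  shows "\<exists>p\<in>{a, x}. \<exists>q\<in>{a, x}. q \<in> open_segment o' p \<and> (\<exists>l. l \<noteq> 0 \<and> p - o' = l *\<^sub>R (a - o'))"
proof (cases "h < 1")
  case True
  then have "x \<in> open_segment o' a" unfolding in_open_segment_iff using assms by auto
  moreover have "a - o' = 1 *\<^sub>R (a - o')" by simp
  ultimately show ?thesis by (metis insertI1 insertI2 one_neq_zero)
next
  case False
  moreover have "h \<noteq> 1" using assms by auto
  ultimately have "h > 1" by simp
  then have "a = o' + (1 / h) *\<^sub>R (x - o')" using assms by simp
  moreover have "o' \<noteq> x" using assms by auto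
  ultimately have "a \<in> open_segment o' x" unfolding in_open_segment_iff using \<open>h > 1\<close> by (metis divide_less_eq_1_pos less_trans zero_less_divide_1_iff zero_less_one)
  moreover have "x - o' = h *\<^sub>R (a - o')" using assms by simp
  ultimately show ?thesis using assms(3) by (metis insertI1 insertI2 less_irrefl)
qed

text \<open>A third point of the line shares its ray from \<open>o'\<close> with \<open>a\<close> or
  with \<open>b\<close>.\<close>

lemma nested_on_line:
  assumes oab: "o' \<in> open_segment a b" and x: "det2 (a - o') (x - o') = 0" "x \<noteq> o'" "x \<noteq> a" "x \<noteq> b"
  shows "\<exists>p\<in>{a, b, x}. \<exists>q\<in>{a, b, x}. q \<in> open_segment o' p \<and> (\<exists>l. l \<noteq> 0 \<and> p - o' = l *\<^sub>R (a - o'))"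
proof -
  obtain k where k: "k > 0" "b = o' - k *\<^sub>R (a - o')" and ao: "a \<noteq> o'"
    using oab unfolding in_open_segment_iff_opposite by blast
  obtain h where h: "x - o' = h *\<^sub>R (a - o')"
    using det2_eq_0_imp_parallel[OF _ x(1)] ao by auto
  then have xh: "x = o' + h *\<^sub>R (a - o')" by (simp add: algebra_simps)
  have "h \<noteq> 0" using h x(2) by auto
  show ?thesis
  proof (cases "h > 0")
    case True
    from nested_on_ray[OF ao xh True x(3)] show ?thesis by blast
  next
    case False
    have bo: "b - o' = (- k) *\<^sub>R (a - o')" using k by simp
    have "x = o' + (- h / k) *\<^sub>R (b - o')" unfolding bo using xh k by simp
    moreover have "- h / k > 0" using False \<open>h \<noteq> 0\<close> k by (simp add: field_simps)
    moreover have "b \<noteq> o'" using bo ao k by auto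
    ultimately obtain p q l where pq: "p \<in> {b, x}" "q \<in> {b, x}" "q \<in> open_segment o' p" "l \<noteq> 0"
      "p - o' = l *\<^sub>R (b - o')"
      using nested_on_ray[of b o' x "- h / k"] x(4) by blast
    have "p - o' = (l * - k) *\<^sub>R (a - o')" using pq(5) unfolding bo by simp
    moreover have "l * - k \<noteq> 0" using pq k by simp
    ultimately show ?thesis using pq by blast
  qed
qed

text \<open>All of \<open>S\<close> lies on the two crossing lines. If each line carried a further
  point off \<open>o'\<close>, nested pairs on two transversal rays from \<open>o'\<close> would
  form a cut triangle. So one of the lines contains all but two points of \<open>S\<close>, and
  these two lie on opposite sides of it.\<close>

lemma crossing_imp_separating_line:
  assumes cc: "crossing_closed E" and ncut: "\<not> cut_triangle E" and "S \<subseteq> E"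
    and S: "a \<in> S" "b \<in> S" "c \<in> S" "d \<in> S"
    and ab: "o' \<in> open_segment a b" and cd: "o' \<in> open_segment c d"
    and det: "det2 (a - o') (c - o') \<noteq> 0"
  shows "all_but_two_on_separating_line S"
proof -
  have E: "a \<in> E" "b \<in> E" "c \<in> E" "d \<in> E" using S \<open>S \<subseteq> E\<close> by auto
  have oE: "o' \<in> E" using crossing_closedD[OF cc ab cd E det] .
  obtain k where k: "k > 0" "d = o' - k *\<^sub>R (c - o')"
    using cd unfolding in_open_segment_iff_opposite by blast
  have dk: "d - o' = (- k) *\<^sub>R (c - o')" using k by simp
  \<comment> \<open>A point on neither line is strictly on the side of \<open>c\<close> or of
    \<open>d\<close> with respect to \<open>ab\<close>, but on a different ray from
    \<open>o'\<close>.\<close>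
  have lines: "det2 (a - o') (x - o') = 0 \<or> det2 (c - o') (x - o') = 0" if "x \<in> S" for x
  proof (rule ccontr)
    assume neg: "\<not> ?thesis"
    have x: "x \<in> E" using that \<open>S \<subseteq> E\<close> by blast
    show False
    proof (cases "det2 (a - o') (c - o') * det2 (a - o') (x - o') > 0")
      case True
      then show False
        using cut_triangle_of_same_side[OF cc oE E(1,2,3) x ab] neg ncut by blast
    next
      case False
      then have "det2 (a - o') (c - o') * det2 (a - o') (x - o') < 0"
        using neg det by (simp add: not_less order.order_iff_strict)
      then have "det2 (a - o') (d - o') * det2 (a - o') (x - o') > 0"
        unfolding dk det2_scaleR_right using k(1) by (simp add: mult_less_0_iff zero_less_mult_iff mult.assoc)
      moreover have "det2 (d - o') (x - o') \<noteq> 0"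
        unfolding dk det2_scaleR_left using k(1) neg by simp
      ultimately show False
        using cut_triangle_of_same_side[OF cc oE E(1,2,4) x ab] ncut by blast
    qed
  qed
  have sw: "det2 (c - o') (a - o') \<noteq> 0" using det det2_swap[of "c - o'"] by simp
  show ?thesis
  proof (rule ccontr)
    assume neg: "\<not> ?thesis"
    \<comment> \<open>As case (iii) fails for the line \<open>ab\<close>, there is a further point
      \<open>y\<close> off it, which \<open>lines\<close> puts on \<open>cd\<close>;
      \<open>x\<close> is found likewise on \<open>ab\<close>.\<close>
    obtain y where y: "y \<in> S" "y \<noteq> c" "y \<noteq> d" "det2 (a - o') (y - o') \<noteq> 0"
      using separating_lineI[OF S(3,4) cd det] neg by blast
    obtain x where x: "x \<in> S" "x \<noteq> a" "x \<noteq> b" "det2 (c - o') (x - o') \<noteq> 0"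
      using separating_lineI[OF S(1,2) ab sw] neg by blast
    have "y \<noteq> o'" "x \<noteq> o'" using x y by auto
    obtain p q l where p: "p \<in> {a, b, x}" "q \<in> {a, b, x}" "q \<in> open_segment o' p"
      "l \<noteq> 0" "p - o' = l *\<^sub>R (a - o')"
      using nested_on_line[OF ab _ \<open>x \<noteq> o'\<close>] x lines[OF x(1)] by blast
    obtain p' q' l' where p': "p' \<in> {c, d, y}" "q' \<in> {c, d, y}" "q' \<in> open_segment o' p'"
      "l' \<noteq> 0" "p' - o' = l' *\<^sub>R (c - o')"
      using nested_on_line[OF cd _ \<open>y \<noteq> o'\<close>] y lines[OF y(1)] by blast
    have "det2 (p - o') (p' - o') \<noteq> 0"
      unfolding p(5) p'(5) det2_scaleR_left det2_scaleR_right using p p' det by simp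
    moreover have "p \<in> E" "q \<in> E" "p' \<in> E" "q' \<in> E" using p p' E x y \<open>S \<subseteq> E\<close> by auto
    ultimately have "cut_triangle E" using cut_triangleI oE p(3) p'(3) by blast
    then show False using ncut by simp
  qed
qed

section \<open>Point sets without crossings\<close>

text \<open>The barycentric coordinate of \<open>x\<close> at the first vertex, as a quotient of
  signed areas; rotating the vertices gives the other two coordinates.\<close>

definition weight :: "point \<Rightarrow> point \<Rightarrow> point \<Rightarrow> point \<Rightarrow> real" where
  "weight A B C x = det2 (B - x) (C - x) / det2 (B - A) (C - A)"

lemma weight_swap: "weight A C B x = weight A B C x"
  unfolding weight_def by (simp add: det2_swap[of "C - x"] det2_swap[of "C - A"])

lemma det2_rotate: "det2 (C - B) (A - B) = det2 (B - A) (C - A)"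
  by (simp add: det2_def algebra_simps)

lemma sum_weights:
  assumes "det2 (B - A) (C - A) \<noteq> 0"
  shows "weight A B C x + weight B C A x + weight C A B x = 1"
proof -
  have "det2 (B - x) (C - x) + det2 (C - x) (A - x) + det2 (A - x) (B - x) = det2 (B - A) (C - A)"
    by (simp add: det2_def algebra_simps)
  then show ?thesis
    using assms unfolding weight_def det2_rotate[of C B A] det2_rotate[of A C B]
    by (simp flip: add_divide_distrib)
qed

lemma weight_combination:
  assumes "det2 (B - A) (C - A) \<noteq> 0"
  shows "x = weight A B C x *\<^sub>R A + weight B C A x *\<^sub>R B + weight C A B x *\<^sub>R C"
proof -
  have "weight B C A x = det2 (x - A) (C - A) / det2 (B - A) (C - A)"
    "weight C A B x = det2 (B - A) (x - A) / det2 (B - A) (C - A)"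
    unfolding weight_def det2_rotate[of C B A] det2_rotate[of A C B]
    by (simp_all add: det2_def algebra_simps)
  then have "x - A = weight B C A x *\<^sub>R (B - A) + weight C A B x *\<^sub>R (C - A)"
    using det2_basis[OF assms, of "x - A"] by simp
  then have "x = (1 - weight B C A x - weight C A B x) *\<^sub>R A + weight B C A x *\<^sub>R B + weight C A B x *\<^sub>R C"
    by (simp add: algebra_simps)
  also have "1 - weight B C A x - weight C A B x = weight A B C x"
    using sum_weights[OF assms, of x] by simp
  finally show ?thesis .
qed

definition crossing_free :: "point set \<Rightarrow> bool" where
  "crossing_free S \<longleftrightarrow> (\<forall>a\<in>S. \<forall>b\<in>S. \<forall>c\<in>S. \<forall>d\<in>S. \<forall>z.
     z \<in> open_segment a b \<longrightarrow> z \<in> open_segment c d \<longrightarrow> det2 (a - z) (c - z) = 0)"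

text \<open>Dividing by the common total weight turns the equation into a common point of the open
  segments \<open>pq\<close> and \<open>st\<close>. In a crossing-free set these cannot be
  transversal.\<close>

lemma crossing_free_Radon:
  assumes "crossing_free S" and S: "p \<in> S" "q \<in> S" "s \<in> S" "t \<in> S"
    and eq: "a *\<^sub>R p + b *\<^sub>R q = c *\<^sub>R s + d *\<^sub>R t"
    and pos: "a > 0" "b > 0" "c > 0" "d > 0" and sum: "a + b = c + d"
  shows "det2 (p - q) (s - t) = 0"
proof (cases "p = q \<or> s = t")
  case False
  define n where "n = a + b"
  have n: "n > 0" "n = c + d" unfolding n_def using pos sum by auto
  define z where "z = (1 / n) *\<^sub>R (a *\<^sub>R p + b *\<^sub>R q)"
  have seg: "z \<in> open_segment u v" and dir: "u - z = (l / n) *\<^sub>R (u - v)"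
    if "z = (1 / n) *\<^sub>R (k *\<^sub>R u + l *\<^sub>R v)" "n = k + l" "k > 0" "l > 0" "u \<noteq> v" for u v k l
  proof -
    have k: "k = n - l" using that by simp
    have z: "z = u + (l / n) *\<^sub>R (v - u)"
    proof -
      have kn: "k / n = 1 - l / n" unfolding k using n by (simp add: diff_divide_distrib)
      have zn: "z = (k / n) *\<^sub>R u + (l / n) *\<^sub>R v"
        unfolding that(1) by (simp add: scaleR_add_right)
      show ?thesis unfolding zn kn by (simp add: algebra_simps)
    qed
    show "z \<in> open_segment u v"
      unfolding in_open_segment_iff using z that n by (intro conjI exI[of _ "l / n"]) auto
    show "u - z = (l / n) *\<^sub>R (u - v)" unfolding z by (simp add: algebra_simps)
  qed
  have z: "z = (1 / n) *\<^sub>R (a *\<^sub>R p + b *\<^sub>R q)" "z = (1 / n) *\<^sub>R (c *\<^sub>R s + d *\<^sub>R t)"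
    unfolding z_def eq by simp_all
  have "det2 (p - z) (s - z) = 0"
    using assms(1) S seg[OF z(1)] seg[OF z(2)] n n_def pos False unfolding crossing_free_def by blast
  then show ?thesis
    using dir[OF z(1) n_def] dir[OF z(2)] n pos False by (simp add: det2_scaleR_left det2_scaleR_right)
qed auto

definition hull_triangle :: "point set \<Rightarrow> point \<Rightarrow> point \<Rightarrow> point \<Rightarrow> bool" where
  "hull_triangle S A B C \<longleftrightarrow> A \<in> S \<and> B \<in> S \<and> C \<in> S \<and> det2 (B - A) (C - A) \<noteq> 0 \<and>
     (\<forall>x\<in>S. weight A B C x \<ge> 0 \<and> weight B C A x \<ge> 0 \<and> weight C A B x \<ge> 0)"

lemma hull_triangle_rotate: "hull_triangle S A B C \<Longrightarrow> hull_triangle S B C A"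
  unfolding hull_triangle_def det2_rotate by auto

lemma hull_triangle_swap: "hull_triangle S A B C \<Longrightarrow> hull_triangle S A C B"
  unfolding hull_triangle_def
  by (auto simp: weight_swap det2_swap[of "C - A"])

text \<open>If \<gamma> < 0, the two upper bounds and the sum 1 force \<alpha>, \<beta> > 0. Then
  \<alpha> A + \<beta> B = x + (-\<gamma>) C shows that \<open>AB\<close> crosses
  \<open>xC\<close>.\<close>

lemma crossing_free_weight_nonneg:
  assumes free: "crossing_free S" and S: "A \<in> S" "B \<in> S" "C \<in> S" "x \<in> S"
    and D: "det2 (B - A) (C - A) \<noteq> 0"
    and le: "weight A B C x \<le> 1" "weight B C A x \<le> 1"
  shows "weight C A B x \<ge> 0"
proof (rule ccontr)
  define \<alpha> \<beta> \<gamma> where "\<alpha> = weight A B C x" and "\<beta> = weight B C A x" and "\<gamma> = weight C A B x"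
  assume "\<not> weight C A B x \<ge> 0"
  then have \<gamma>: "- \<gamma> > 0" unfolding \<gamma>_def by simp
  have sum: "\<alpha> + \<beta> + \<gamma> = 1" unfolding \<alpha>_def \<beta>_def \<gamma>_def by (rule sum_weights[OF D])
  have x: "x = \<alpha> *\<^sub>R A + \<beta> *\<^sub>R B + \<gamma> *\<^sub>R C"
    unfolding \<alpha>_def \<beta>_def \<gamma>_def by (rule weight_combination[OF D])
  have pos: "\<alpha> > 0" "\<beta> > 0" using le sum \<gamma> unfolding \<alpha>_def[symmetric] \<beta>_def[symmetric] by auto
  have "\<alpha> *\<^sub>R A + \<beta> *\<^sub>R B = 1 *\<^sub>R x + (- \<gamma>) *\<^sub>R C" using x by simp
  then have "det2 (A - B) (x - C) = 0"
    using crossing_free_Radon[OF free S(1,2,4,3) _ pos zero_less_one \<gamma>] sum by simp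
  moreover have "det2 (A - B) (x - C) = (\<alpha> + \<beta>) * det2 (B - A) (C - A)"
  proof -
    have \<gamma>': "\<gamma> = 1 - \<alpha> - \<beta>" using sum by simp
    show ?thesis unfolding x \<gamma>' by (simp add: det2_def algebra_simps)
  qed
  ultimately show False using pos D by simp
qed

lemma ex_hull_triangle:
  assumes "finite S" and "\<not> collinear S" and free: "crossing_free S"
  obtains A B C where "hull_triangle S A B C"
proof -
  have "\<exists>a\<in>S. \<exists>b\<in>S. a \<noteq> b"
  proof (rule ccontr)
    assume "\<not> ?thesis"
    \<comment> \<open>This treats a singleton and the empty set at once.\<close>
    then have "S \<subseteq> {SOME x. x \<in> S}" by (metis singletonI someI subsetI)
    then have "collinear S" by (rule collinear_subset[OF collinear_sing])
    then show False using assms(2) by simp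
  qed
  then obtain a b where ab: "a \<in> S" "b \<in> S" "a \<noteq> b" by blast
  then have "insert a (insert b S) = S" by auto
  then obtain c where c: "c \<in> S" "\<not> collinear {a, b, c}"
    using collinear_triples[OF ab(3), of S] assms(2) by auto
  \<comment> \<open>Twice the area. A triple of maximal area bounds every weight by 1, since a
    weight is a quotient of such areas up to sign.\<close>
  define f where "f = (\<lambda>(A, B, C). \<bar>det2 (B - A) (C - A)\<bar>)"
  have "finite (f ` (S \<times> S \<times> S))" using assms(1) by simp
  moreover have "f (a, b, c) \<in> f ` (S \<times> S \<times> S)" using ab c by auto
  ultimately have "Max (f ` (S \<times> S \<times> S)) \<in> f ` (S \<times> S \<times> S)" and ge: "\<And>t. t \<in> S \<times> S \<times> S \<Longrightarrow> f t \<le> Max (f ` (S \<times> S \<times> S))"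
    by (intro Max_in, auto)
  then obtain A B C where ABC: "A \<in> S" "B \<in> S" "C \<in> S" and "Max (f ` (S \<times> S \<times> S)) = f (A, B, C)"
    by auto
  then have max: "\<bar>det2 (y - x) (z - x)\<bar> \<le> \<bar>det2 (B - A) (C - A)\<bar>" if "x \<in> S" "y \<in> S" "z \<in> S" for x y z
    using ge[of "(x, y, z)"] that unfolding f_def by simp
  have "det2 (b - a) (c - a) \<noteq> 0" using c(2) by (simp add: collinear_iff_det2)
  then have D: "det2 (B - A) (C - A) \<noteq> 0" using max[OF ab(1,2) c(1)] by auto
  have le: "weight A B C x \<le> 1" "weight B C A x \<le> 1" "weight C A B x \<le> 1" if "x \<in> S" for x
  proof -
    have "u / v \<le> 1" if "\<bar>u\<bar> \<le> \<bar>v\<bar>" "v \<noteq> 0" for u v :: real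
    proof -
      have "\<bar>u / v\<bar> \<le> 1" using that by (simp add: abs_divide)
      then show ?thesis by linarith
    qed
    then show "weight A B C x \<le> 1" "weight B C A x \<le> 1" "weight C A B x \<le> 1"
      unfolding weight_def det2_rotate[of C B A] det2_rotate[of A C B] using max that ABC D by auto
  qed
  have D': "det2 (C - B) (A - B) \<noteq> 0" "det2 (A - C) (B - C) \<noteq> 0"
    using D by (simp_all add: det2_rotate)
  have "hull_triangle S A B C"
    unfolding hull_triangle_def
    using ABC D crossing_free_weight_nonneg[OF free ABC _ D] crossing_free_weight_nonneg[OF free ABC(2,3,1) _ D'(1)]
      crossing_free_weight_nonneg[OF free ABC(3,1,2) _ D'(2)] le by simp
  then show ?thesis using that by blast
qed

section \<open>Points on an edge of the hull triangle\<close>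

lemma det2_edge_weight:
  assumes "det2 (B - A) (C - A) \<noteq> 0"
  shows "det2 (C - B) (x - B) = weight A B C x * det2 (B - A) (C - A)"
proof -
  have "weight A B C x * det2 (B - A) (C - A) = det2 (B - x) (C - x)"
    unfolding weight_def using assms by simp
  also have "\<dots> = det2 (C - B) (x - B)" by (simp add: det2_def algebra_simps)
  finally show ?thesis ..
qed

text \<open>An edge point \<open>z\<close> of \<open>S\<close> lies between \<open>B\<close> and
  \<open>C\<close>, so without cut triangles all points of \<open>S\<close> off the edge lie on the
  ray from \<open>z\<close> through \<open>A\<close>. If \<open>A\<close> is the only such point,
  this is case (ii). Otherwise \<open>y\<close> is the only edge point besides \<open>B\<close> and
  \<open>C\<close>, and the line \<open>Ay\<close> gives case (iii).\<close>

lemma hull_triangle_edge_point: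
  assumes cc: "crossing_closed E" and ncut: "\<not> cut_triangle E" and "S \<subseteq> E"
    and hull: "hull_triangle S A B C"
    and y: "y \<in> S" "weight A B C y = 0" "y \<noteq> B" "y \<noteq> C"
  shows "all_but_one_on_line S \<or> all_but_two_on_separating_line S"
proof -
  have S: "A \<in> S" "B \<in> S" "C \<in> S" and D: "det2 (B - A) (C - A) \<noteq> 0"
    and nn: "\<And>x. x \<in> S \<Longrightarrow> weight A B C x \<ge> 0 \<and> weight B C A x \<ge> 0 \<and> weight C A B x \<ge> 0"
    using hull unfolding hull_triangle_def by auto
  have E: "A \<in> E" "B \<in> E" "C \<in> E" using S \<open>S \<subseteq> E\<close> by auto
  have edge: "\<exists>c. 0 < c \<and> c < 1 \<and> z = B + c *\<^sub>R (C - B)"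
    if z: "z \<in> S" "weight A B C z = 0" "z \<noteq> B" "z \<noteq> C" for z
  proof -
    define c where "c = weight C A B z"
    have b: "weight B C A z = 1 - c" using sum_weights[OF D, of z] z(2) unfolding c_def by simp
    have eq: "z = B + c *\<^sub>R (C - B)"
      using weight_combination[OF D, of z] unfolding z(2) b c_def[symmetric] by (simp add: algebra_simps)
    moreover have "c \<noteq> 0" "c \<noteq> 1" using eq z(3,4) by auto
    moreover have "c \<ge> 0" "1 - c \<ge> 0" using nn[OF z(1)] b unfolding c_def by auto
    ultimately show ?thesis by (intro exI[of _ c]) auto
  qed
  have BC: "B \<noteq> C" using D by auto
  have ray: "det2 (A - z) (x - z) = 0"
    if z: "z \<in> S" "weight A B C z = 0" "z \<noteq> B" "z \<noteq> C" and x: "x \<in> S" "weight A B C x > 0" for z x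
  proof (rule ccontr)
    assume neg: "\<not> ?thesis"
    obtain c where c: "0 < c" "c < 1" "z = B + c *\<^sub>R (C - B)" using edge[OF z] by blast
    have "z \<in> open_segment B C" unfolding in_open_segment_iff using BC c by blast
    moreover have Bz: "det2 (B - z) (w - z) = - c * (weight A B C w * det2 (B - A) (C - A))" for w
    proof -
      have "det2 (B - z) (w - z) = - c * det2 (C - B) (w - B)"
        unfolding c(3) by (simp add: det2_def algebra_simps)
      then show ?thesis unfolding det2_edge_weight[OF D] .
    qed
    have "weight A B C A = 1" unfolding weight_def using D by simp
    then have "det2 (B - z) (A - z) * det2 (B - z) (x - z)
        = (c * det2 (B - A) (C - A))\<^sup>2 * weight A B C x"
      unfolding Bz by (simp add: power2_eq_square)
    then have "det2 (B - z) (A - z) * det2 (B - z) (x - z) > 0"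
      using c(1) x(2) D by simp
    ultimately show False
      using cut_triangle_of_same_side[OF cc _ E(2,3,1), of z x] neg z(1) x(1) \<open>S \<subseteq> E\<close> ncut by blast
  qed
  show ?thesis
  proof (cases "\<forall>x\<in>S - {A}. weight A B C x = 0")
    case True
    have "S - {A} \<subseteq> {x. rot (C - B) \<bullet> x = rot (C - B) \<bullet> B}"
    proof
      fix x assume "x \<in> S - {A}"
      then have "det2 (C - B) (x - B) = 0" using True det2_edge_weight[OF D] by simp
      then show "x \<in> {x. rot (C - B) \<bullet> x = rot (C - B) \<bullet> B}" by (simp add: inner_rot det2_diff_right)
    qed
    moreover have "rot (C - B) \<bullet> A \<noteq> rot (C - B) \<bullet> B"
      using D det2_rotate[of C B A] by (simp add: inner_rot det2_diff_right)
    moreover have "rot (C - B) \<noteq> 0" using BC by simp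
    ultimately show ?thesis unfolding all_but_one_on_line_def using S(1) by blast
  next
    case False
    then obtain x where x: "x \<in> S" "x \<noteq> A" "weight A B C x > 0"
      using nn by (metis DiffE insertCI order_le_less)
    obtain c where c: "0 < c" "c < 1" "y = B + c *\<^sub>R (C - B)" using edge[OF y] by blast
    \<comment> \<open>By \<open>ray\<close> both \<open>y\<close> and \<open>z\<close> lie on the
      line through \<open>A\<close> and \<open>x\<close>, which meets the edge line only
      once.\<close>
    have unique: "z = y" if z: "z \<in> S" "weight A B C z = 0" "z \<noteq> B" "z \<noteq> C" for z
    proof -
      obtain d where d: "z = B + d *\<^sub>R (C - B)" using edge[OF z] by blast
      have xA: "x - A \<noteq> 0" using x by simp
      have "det2 (x - A) (y - A) = 0" "det2 (x - A) (z - A) = 0"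
        using ray[OF y x(1,3)] ray[OF z x(1,3)] by (simp_all add: det2_def algebra_simps)
      then obtain h h' where "y - A = h *\<^sub>R (x - A)" "z - A = h' *\<^sub>R (x - A)"
        using det2_eq_0_imp_parallel[OF xA] by metis
      then have "det2 (y - A) (z - A) = 0" by (simp add: det2_scaleR_left det2_scaleR_right)
      moreover have "det2 (y - A) (z - A) = (d - c) * det2 (B - A) (C - A)"
        unfolding c(3) d by (simp add: det2_def algebra_simps)
      ultimately have "d = c" using D by simp
      then show ?thesis unfolding c(3) d by simp
    qed
    have "all_but_two_on_separating_line S"
    proof (rule separating_lineI[OF S(2,3)])
      show "y \<in> open_segment B C" unfolding in_open_segment_iff using BC c by blast
      have "det2 (A - y) (B - y) = c * det2 (B - A) (C - A)"
        unfolding c(3) by (simp add: det2_def algebra_simps)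
      then show "det2 (A - y) (B - y) \<noteq> 0" using c D by simp
      fix z assume z: "z \<in> S" "z \<noteq> B" "z \<noteq> C"
      show "det2 (A - y) (z - y) = 0"
      proof (cases "weight A B C z = 0")
        case True
        then show ?thesis using unique z by simp
      next
        case False
        then show ?thesis using ray[OF y z(1)] nn[OF z(1)] by simp
      qed
    qed
    then show ?thesis ..
  qed
qed

text \<open>In terms of the ratios of the weights of \<open>y\<close> to those of \<open>x\<close>,
  the ratio at B cannot lie strictly below that at A and above that at C. With \<open>v\<close> the
  ratio at B, the B-terms of \<open>y\<close> and \<open>v x\<close> cancel, and
  \<open>y + (v c - c') C = v x + (a' - v a) A\<close> would make \<open>yC\<close> cross
  \<open>xA\<close>.\<close>

lemma crossing_free_weight_order:
  assumes free: "crossing_free S" and hull: "hull_triangle S A B C" and S: "x \<in> S" "y \<in> S"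
    and x: "weight A B C x > 0" "weight B C A x > 0" "weight C A B x > 0"
    and y: "weight A B C y > 0" "weight B C A y > 0" "weight C A B y > 0"
    and AB: "weight A B C y * weight B C A x > weight B C A y * weight A B C x"
  shows "weight B C A y * weight C A B x \<le> weight C A B y * weight B C A x"
proof (rule ccontr)
  assume BC: "\<not> ?thesis"
  have ABC: "A \<in> S" "B \<in> S" "C \<in> S" and D: "det2 (B - A) (C - A) \<noteq> 0"
    using hull unfolding hull_triangle_def by auto
  define a b c a' b' c' where "a = weight A B C x" and "b = weight B C A x" and "c = weight C A B x"
    and "a' = weight A B C y" and "b' = weight B C A y" and "c' = weight C A B y"
  note defs = a_def[symmetric] b_def[symmetric] c_def[symmetric] a'_def[symmetric] b'_def[symmetric] c'_def[symmetric]
  note x = x[unfolded defs] and y = y[unfolded defs] and AB = AB[unfolded defs] and BC = BC[unfolded defs]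
  have xeq: "x = a *\<^sub>R A + b *\<^sub>R B + c *\<^sub>R C" and yeq: "y = a' *\<^sub>R A + b' *\<^sub>R B + c' *\<^sub>R C"
    unfolding a_def b_def c_def a'_def b'_def c'_def by (rule weight_combination[OF D])+
  have sum: "a + b + c = 1" "a' + b' + c' = 1"
    unfolding a_def b_def c_def a'_def b'_def c'_def by (rule sum_weights[OF D])+
  define v where "v = b' / b"
  have bv: "b' = v * b" unfolding v_def using x by simp
  have v: "v > 0" unfolding v_def using x y by simp
  have "v * c - c' > 0" "a' - v * a > 0"
    using AB BC x unfolding bv by (simp_all add: algebra_simps)
  moreover have "1 *\<^sub>R y + (v * c - c') *\<^sub>R C = v *\<^sub>R x + (a' - v * a) *\<^sub>R A"
    unfolding xeq yeq bv by (simp add: algebra_simps)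
  moreover have "1 + (v * c - c') = v + (a' - v * a)"
  proof -
    have "v * (a + b + c) = v" using sum by simp
    then show ?thesis using sum(2) unfolding bv by (simp add: algebra_simps)
  qed
  ultimately have "det2 (y - C) (x - A) = 0"
    using crossing_free_Radon[OF free S(2) ABC(3) S(1) ABC(1) _ zero_less_one _ v] by blast
  moreover have "det2 (y - C) (x - A) = (a' * b - b' * a + b') * det2 (B - A) (C - A)"
  proof -
    have c: "c = 1 - a - b" "c' = 1 - a' - b'" using sum by auto
    show ?thesis unfolding xeq yeq c by (simp add: det2_def algebra_simps)
  qed
  ultimately show False using AB y D by simp
qed

text \<open>Under all six orders of the vertices, the previous lemma says that none of the three
  weight ratios is strictly between the other two. Hence two of them coincide.\<close>

lemma crossing_free_interior_pair:
  assumes free: "crossing_free S" and hull: "hull_triangle S A B C" and S: "x \<in> S" "y \<in> S"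
    and x: "weight A B C x > 0" "weight B C A x > 0" "weight C A B x > 0"
    and y: "weight A B C y > 0" "weight B C A y > 0" "weight C A B y > 0"
  shows "weight B C A x * weight C A B y = weight C A B x * weight B C A y
    \<or> weight C A B x * weight A B C y = weight A B C x * weight C A B y
    \<or> weight A B C x * weight B C A y = weight B C A x * weight A B C y"
proof -
  have h: "hull_triangle S B C A" "hull_triangle S C A B" "hull_triangle S A C B"
    "hull_triangle S C B A" "hull_triangle S B A C"
    using hull hull_triangle_rotate hull_triangle_swap by blast+
  have sw: "weight A C B = weight A B C" "weight C B A = weight C A B" "weight B A C = weight B C A"
    using weight_swap by blast+
  note order = crossing_free_weight_order[OF free _ S]
  have "weight A B C y * weight B C A x > weight B C A y * weight A B C x \<Longrightarrow>
      weight B C A y * weight C A B x \<le> weight C A B y * weight B C A x"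
    using order[OF hull x y] .
  moreover have "weight B C A y * weight C A B x > weight C A B y * weight B C A x \<Longrightarrow>
      weight C A B y * weight A B C x \<le> weight A B C y * weight C A B x"
    using order[OF h(1) x(2,3,1) y(2,3,1)] .
  moreover have "weight C A B y * weight A B C x > weight A B C y * weight C A B x \<Longrightarrow>
      weight A B C y * weight B C A x \<le> weight B C A y * weight A B C x"
    using order[OF h(2) x(3,1,2) y(3,1,2)] .
  moreover have "weight A B C y * weight C A B x > weight C A B y * weight A B C x \<Longrightarrow>
      weight C A B y * weight B C A x \<le> weight B C A y * weight C A B x"
    using order[OF h(3), unfolded sw] x y by blast
  moreover have "weight C A B y * weight B C A x > weight B C A y * weight C A B x \<Longrightarrow>
      weight B C A y * weight A B C x \<le> weight A B C y * weight B C A x"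
    using order[OF h(4), unfolded sw] x y by blast
  moreover have "weight B C A y * weight A B C x > weight A B C y * weight B C A x \<Longrightarrow>
      weight A B C y * weight C A B x \<le> weight C A B y * weight A B C x"
    using order[OF h(5), unfolded sw] x y by blast
  ultimately show ?thesis by (smt (verit) mult.commute)
qed

section \<open>Collinearity with a vertex and sets with three directions\<close>

lemma det2_from_vertex:
  assumes D: "det2 (B - A) (C - A) \<noteq> 0"
  shows "det2 (x - A) (y - A)
    = (weight B C A x * weight C A B y - weight C A B x * weight B C A y) * det2 (B - A) (C - A)"
proof -
  have "z - A = weight B C A z *\<^sub>R (B - A) + weight C A B z *\<^sub>R (C - A)" for z
  proof -
    have "weight A B C z = 1 - weight B C A z - weight C A B z"
      using sum_weights[OF D, of z] by simp
    then have "z = (1 - weight B C A z - weight C A B z) *\<^sub>R A + weight B C A z *\<^sub>R B + weight C A B z *\<^sub>R C"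
      using weight_combination[OF D, of z] by simp
    then have "z - A = (1 - weight B C A z - weight C A B z) *\<^sub>R A + weight B C A z *\<^sub>R B + weight C A B z *\<^sub>R C - A"
      by (rule arg_cong)
    then show ?thesis by (simp add: algebra_simps)
  qed
  from this[of x] this[of y] show ?thesis by (simp only: det2_combination)
qed

text \<open>The allowed directions are vertical, horizontal and antidiagonal. The pair
  \<open>x\<close>, \<open>y\<close> is vertical, so \<open>z\<close> sees one of them horizontally
  and the other antidiagonally; no fourth point sees all corners of such a triangle in allowed
  directions.\<close>

lemma four_points_three_directions:
  fixes x1 x2 y1 y2 z1 z2 w1 w2 :: real
  assumes "x1 = y1" "x2 \<noteq> y2" "z1 \<noteq> x1"
    and "x2 = z2 \<or> x1 + x2 = z1 + z2" "y2 = z2 \<or> y1 + y2 = z1 + z2"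
    and "w1 = x1 \<or> w2 = x2 \<or> w1 + w2 = x1 + x2"
    and "w1 = y1 \<or> w2 = y2 \<or> w1 + w2 = y1 + y2"
    and "w1 = z1 \<or> w2 = z2 \<or> w1 + w2 = z1 + z2"
  shows "w1 = x1 \<and> w2 = x2 \<or> w1 = y1 \<and> w2 = y2 \<or> w1 = z1 \<and> w2 = z2"
  using assms by (smt (verit))

lemma three_directions_parallel_pair:
  fixes P Q :: "'a \<Rightarrow> real"
  assumes pair: "\<And>x y. x \<in> I \<Longrightarrow> y \<in> I \<Longrightarrow> P x = P y \<or> Q x = Q y \<or> P x + Q x = P y + Q y"
    and inj: "\<And>x y. x \<in> I \<Longrightarrow> y \<in> I \<Longrightarrow> P x = P y \<Longrightarrow> Q x = Q y \<Longrightarrow> x = y"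
    and xy: "x \<in> I" "y \<in> I" "x \<noteq> y" "P x = P y"
  shows "(\<forall>z\<in>I. P z = P x) \<or> card I = 3"
proof (rule disjCI)
  assume neg: "card I \<noteq> 3"
  show "\<forall>z\<in>I. P z = P x"
  proof (rule ccontr)
    assume "\<not> ?thesis"
    then obtain z where z: "z \<in> I" "P z \<noteq> P x" by blast
    have "Q x \<noteq> Q y" using inj xy by blast
    have "w \<in> {x, y, z}" if "w \<in> I" for w
    proof -
      have "P w = P x \<and> Q w = Q x \<or> P w = P y \<and> Q w = Q y \<or> P w = P z \<and> Q w = Q z"
        by (rule four_points_three_directions[OF xy(4) \<open>Q x \<noteq> Q y\<close> z(2)])
          (use pair xy z that in metis)+
      then show ?thesis using inj that xy(1,2) z(1) by blast
    qed
    then have "I = {x, y, z}" using xy z by blast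
    moreover have "z \<noteq> x" "z \<noteq> y" using z xy by auto
    ultimately show False using neg xy(3) by auto
  qed
qed

text \<open>Any two distinct points of \<open>I\<close> are joined in one of the three directions.
  The linear changes from (P, Q) to (Q, P) and to (P + Q, -Q) permute the directions, so each case
  reduces to equal \<open>P\<close>.\<close>

lemma three_directions:
  fixes P Q :: "'a \<Rightarrow> real"
  assumes pair: "\<And>x y. x \<in> I \<Longrightarrow> y \<in> I \<Longrightarrow> P x = P y \<or> Q x = Q y \<or> P x + Q x = P y + Q y"
    and inj: "\<And>x y. x \<in> I \<Longrightarrow> y \<in> I \<Longrightarrow> P x = P y \<Longrightarrow> Q x = Q y \<Longrightarrow> x = y"
  shows "(\<forall>x\<in>I. \<forall>y\<in>I. P x = P y) \<or> (\<forall>x\<in>I. \<forall>y\<in>I. Q x = Q y)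
    \<or> (\<forall>x\<in>I. \<forall>y\<in>I. P x + Q x = P y + Q y) \<or> card I = 3"
proof (cases "\<exists>x\<in>I. \<exists>y\<in>I. x \<noteq> y")
  case True
  then obtain x y where xy: "x \<in> I" "y \<in> I" "x \<noteq> y" by blast
  have "(\<forall>z\<in>I. P z = P x) \<or> (\<forall>z\<in>I. Q z = Q x) \<or> (\<forall>z\<in>I. P z + Q z = P x + Q x) \<or> card I = 3"
    using pair[OF xy(1,2)]
  proof (elim disjE)
    assume "P x = P y"
    from three_directions_parallel_pair[of I P Q, OF pair inj xy this] show ?thesis by blast
  next
    assume Q: "Q x = Q y"
    have "(\<forall>z\<in>I. Q z = Q x) \<or> card I = 3"
    proof (rule three_directions_parallel_pair[of I Q P, OF _ _ xy Q])
      show "Q x = Q y \<or> P x = P y \<or> Q x + P x = Q y + P y" if "x \<in> I" "y \<in> I" for x y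
        using pair[OF that] by auto
    qed (use inj in blast)
    then show ?thesis by blast
  next
    assume PQ: "P x + Q x = P y + Q y"
    have "(\<forall>z\<in>I. P z + Q z = P x + Q x) \<or> card I = 3"
    proof (rule three_directions_parallel_pair[of I "\<lambda>z. P z + Q z" "\<lambda>z. - Q z", OF _ _ xy PQ])
      show "P x + Q x = P y + Q y \<or> - Q x = - Q y \<or> P x + Q x + - Q x = P y + Q y + - Q y"
        if "x \<in> I" "y \<in> I" for x y
        using pair[OF that] by auto
      show "x = y" if "x \<in> I" "y \<in> I" "P x + Q x = P y + Q y" "- Q x = - Q y" for x y
        using inj[OF that(1,2)] that(3,4) by simp
    qed
    then show ?thesis by blast
  qed
  then show ?thesis by metis
next
  case False
  then have "x = y" if "x \<in> I" "y \<in> I" for x y using that by blast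
  then show ?thesis by metis
qed

lemma vertex_line_imp_separating_line:
  assumes hull: "hull_triangle S A B C" and x0: "x0 \<in> S"
    and pos: "weight B C A x0 > 0" "weight C A B x0 > 0"
    and line: "\<And>x. x \<in> S \<Longrightarrow> x \<noteq> B \<Longrightarrow> x \<noteq> C \<Longrightarrow> det2 (x0 - A) (x - A) = 0"
  shows "all_but_two_on_separating_line S"
proof -
  have S: "B \<in> S" "C \<in> S" and D: "det2 (B - A) (C - A) \<noteq> 0"
    using hull unfolding hull_triangle_def by auto
  define b c where "b = weight B C A x0" and "c = weight C A B x0"
  have bc: "b > 0" "c > 0" using pos unfolding b_def c_def by auto
  \<comment> \<open>The point where the line from \<open>A\<close> through \<open>x0\<close> meets
    \<open>BC\<close>; there the weights of B and C are in the proportion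
    \<open>b : c\<close>.\<close>
  define z where "z = B + (c / (b + c)) *\<^sub>R (C - B)"
  have x0A: "x0 - A = b *\<^sub>R (B - A) + c *\<^sub>R (C - A)"
  proof -
    have a: "weight A B C x0 = 1 - b - c" using sum_weights[OF D, of x0] unfolding b_def c_def by simp
    have "x0 = (1 - b - c) *\<^sub>R A + b *\<^sub>R B + c *\<^sub>R C"
      using weight_combination[OF D, of x0] unfolding a b_def[symmetric] c_def[symmetric] .
    then show ?thesis by (simp add: algebra_simps)
  qed
  have "(b + c) *\<^sub>R (z - A) = (b + c) *\<^sub>R (B - A) + ((b + c) * (c / (b + c))) *\<^sub>R (C - B)"
    unfolding z_def by (simp add: algebra_simps)
  also have "(b + c) * (c / (b + c)) = c" using bc by simp
  also have "(b + c) *\<^sub>R (B - A) + c *\<^sub>R (C - B) = x0 - A" unfolding x0A by (simp add: algebra_simps)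
  finally have zA: "x0 - A = (b + c) *\<^sub>R (z - A)" by simp
  show ?thesis
  proof (rule separating_lineI[OF S])
    have "B \<noteq> C" using D by auto
    then show "z \<in> open_segment B C"
      unfolding in_open_segment_iff z_def using bc by (intro conjI exI[of _ "c / (b + c)"]) auto
    have "det2 (x0 - A) (B - z) = - (c / (b + c)) * det2 (x0 - A) (C - B)"
      unfolding z_def by (simp add: det2_linear)
    also have "det2 (x0 - A) (C - B) = (b + c) * det2 (B - A) (C - A)"
      unfolding x0A by (simp add: det2_def algebra_simps)
    finally show "det2 (x0 - A) (B - z) \<noteq> 0" using bc D by simp
    fix x assume x: "x \<in> S" "x \<noteq> B" "x \<noteq> C"
    have "det2 (x0 - A) (x - z) = det2 (x0 - A) (x - A) - det2 (x0 - A) (z - A)"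
      by (simp add: det2_diff_right)
    also have "det2 (x0 - A) (z - A) = 0" unfolding zA by (simp add: det2_scaleR_left)
    finally show "det2 (x0 - A) (x - z) = 0" using line[OF x] by simp
  qed
qed

text \<open>Logarithms of weight ratios turn lines through A, B and C into level sets of
  \<open>P\<close>, \<open>Q\<close> and \<open>P + Q\<close>, and \<open>three_directions\<close>
  applies. No interior point gives case (ii), all of them on one line through a vertex gives (iii),
  and otherwise there are three, which gives (iv).\<close>

lemma interior_points_exceptional:
  assumes "finite S" and free: "crossing_free S" and hull: "hull_triangle S A B C"
    and inner: "\<And>x. x \<in> S - {A, B, C} \<Longrightarrow> weight A B C x > 0 \<and> weight B C A x > 0 \<and> weight C A B x > 0"
  shows "exceptional S"
proof -
  define I where "I = S - {A, B, C}"
  have S: "A \<in> S" "B \<in> S" "C \<in> S" and D: "det2 (B - A) (C - A) \<noteq> 0"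
    using hull unfolding hull_triangle_def by auto
  have D': "det2 (C - B) (A - B) \<noteq> 0" "det2 (A - C) (B - C) \<noteq> 0" using D by (simp_all add: det2_rotate)
  have hulls: "hull_triangle S B C A" "hull_triangle S C A B"
    using hull hull_triangle_rotate by blast+
  have pos: "weight A B C x > 0" "weight B C A x > 0" "weight C A B x > 0" if "x \<in> I" for x
    using inner that unfolding I_def by auto
  define P where "P = (\<lambda>x. ln (weight B C A x) - ln (weight C A B x))"
  define Q where "Q = (\<lambda>x. ln (weight C A B x) - ln (weight A B C x))"
  have ln_iff: "ln u - ln v = ln u' - ln v' \<longleftrightarrow> u * v' = v * u'"
    if "u > 0" "v > 0" "u' > 0" "v' > 0" for u v u' v' :: real
  proof -
    have "u * v' = v * u' \<longleftrightarrow> ln (u * v') = ln (v * u')" using that by simp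
    then show ?thesis using that by (auto simp: ln_mult)
  qed
  have lineA: "P x = P y \<longleftrightarrow> det2 (x - A) (y - A) = 0"
    and lineB: "Q x = Q y \<longleftrightarrow> det2 (x - B) (y - B) = 0"
    and lineC: "P x + Q x = P y + Q y \<longleftrightarrow> det2 (x - C) (y - C) = 0"
    and some_line: "det2 (x - A) (y - A) = 0 \<or> det2 (x - B) (y - B) = 0 \<or> det2 (x - C) (y - C) = 0"
    if xy: "x \<in> I" "y \<in> I" for x y
  proof -
    note px = pos[OF xy(1)] and py = pos[OF xy(2)]
    show "P x = P y \<longleftrightarrow> det2 (x - A) (y - A) = 0"
      unfolding P_def ln_iff[OF px(2,3) py(2,3)] det2_from_vertex[OF D, of x y] using D by simp
    show "Q x = Q y \<longleftrightarrow> det2 (x - B) (y - B) = 0"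
      unfolding Q_def ln_iff[OF px(3,1) py(3,1)] det2_from_vertex[OF D'(1), of x y] using D'(1) by simp
    have "P x + Q x = P y + Q y \<longleftrightarrow> ln (weight A B C x) - ln (weight B C A x) = ln (weight A B C y) - ln (weight B C A y)"
      unfolding P_def Q_def by auto
    then show "P x + Q x = P y + Q y \<longleftrightarrow> det2 (x - C) (y - C) = 0"
      unfolding ln_iff[OF px(1,2) py(1,2)] det2_from_vertex[OF D'(2), of x y] using D'(2) by simp
    have "x \<in> S" "y \<in> S" using xy unfolding I_def by auto
    from crossing_free_interior_pair[OF free hull this px py]
    show "det2 (x - A) (y - A) = 0 \<or> det2 (x - B) (y - B) = 0 \<or> det2 (x - C) (y - C) = 0"
      unfolding det2_from_vertex[OF D, of x y] det2_from_vertex[OF D'(1), of x y] det2_from_vertex[OF D'(2), of x y] by auto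
  qed
  have inj: "x = y" if xy: "x \<in> I" "y \<in> I" and eq: "P x = P y" "Q x = Q y" for x y
  proof -
    note px = pos[OF xy(1)] and py = pos[OF xy(2)]
    \<comment> \<open>Equal ratios make the weights of \<open>y\<close> proportional to those of
      \<open>x\<close> with factor \<open>v\<close>; both triples sum to 1, so
      \<open>v = 1\<close>.\<close>
    define v where "v = weight C A B y / weight C A B x"
    have "weight B C A x * weight C A B y = weight C A B x * weight B C A y"
      using eq(1) unfolding P_def ln_iff[OF px(2,3) py(2,3)] .
    then have b: "weight B C A y = v * weight B C A x" unfolding v_def using px by (simp add: field_simps)
    have "weight C A B x * weight A B C y = weight A B C x * weight C A B y"
      using eq(2) unfolding Q_def ln_iff[OF px(3,1) py(3,1)] .
    then have a: "weight A B C y = v * weight A B C x" unfolding v_def using px by (simp add: field_simps)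
    have c: "weight C A B y = v * weight C A B x" unfolding v_def using px by simp
    have "v * (weight A B C x + weight B C A x + weight C A B x) = 1"
      using sum_weights[OF D, of y] unfolding a b c by (simp add: algebra_simps)
    then have "v = 1" using sum_weights[OF D, of x] by simp
    then show "x = y" using weight_combination[OF D, of x] weight_combination[OF D, of y] a b c by simp
  qed
  have "P x = P y \<or> Q x = Q y \<or> P x + Q x = P y + Q y" if "x \<in> I" "y \<in> I" for x y
    using lineA[OF that] lineB[OF that] lineC[OF that] some_line[OF that] by blast
  from three_directions[of I P Q, OF this inj]
  have cases: "(\<forall>x\<in>I. \<forall>y\<in>I. det2 (x - A) (y - A) = 0) \<or> (\<forall>x\<in>I. \<forall>y\<in>I. det2 (x - B) (y - B) = 0)
    \<or> (\<forall>x\<in>I. \<forall>y\<in>I. det2 (x - C) (y - C) = 0) \<or> card I = 3"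
    using lineA lineB lineC by blast
  have vertex_line: "all_but_two_on_separating_line S"
    if hullV: "hull_triangle S V V' V''" and V: "{V, V', V''} = {A, B, C}"
      and posV: "\<And>x. x \<in> I \<Longrightarrow> weight V' V'' V x > 0 \<and> weight V'' V V' x > 0"
      and on: "\<forall>x\<in>I. \<forall>y\<in>I. det2 (x - V) (y - V) = 0" and ne: "I \<noteq> {}" for V V' V''
  proof -
    obtain x0 where x0: "x0 \<in> I" using ne by blast
    have "det2 (x0 - V) (x - V) = 0" if "x \<in> S" "x \<noteq> V'" "x \<noteq> V''" for x
    proof (cases "x = V")
      case False
      then have "x \<in> I" using that V unfolding I_def by blast
      then show ?thesis using on x0 by blast
    qed simp
    then show ?thesis
      using vertex_line_imp_separating_line[OF hullV] x0 posV[OF x0] unfolding I_def by blast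
  qed
  consider (empty) "I = {}"
    | (line) "I \<noteq> {}" "(\<forall>x\<in>I. \<forall>y\<in>I. det2 (x - A) (y - A) = 0) \<or> (\<forall>x\<in>I. \<forall>y\<in>I. det2 (x - B) (y - B) = 0)
    \<or> (\<forall>x\<in>I. \<forall>y\<in>I. det2 (x - C) (y - C) = 0)"
    | (three) "card I = 3" "\<not> ((\<forall>x\<in>I. \<forall>y\<in>I. det2 (x - A) (y - A) = 0) \<or> (\<forall>x\<in>I. \<forall>y\<in>I. det2 (x - B) (y - B) = 0)
    \<or> (\<forall>x\<in>I. \<forall>y\<in>I. det2 (x - C) (y - C) = 0))"
    using cases by blast
  then show ?thesis
  proof cases
    case empty
    then have "S - {A} \<subseteq> {x. rot (C - B) \<bullet> x = rot (C - B) \<bullet> B}"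
      unfolding I_def by (auto simp: inner_rot det2_def algebra_simps)
    moreover have "rot (C - B) \<bullet> A \<noteq> rot (C - B) \<bullet> B"
      using D'(1) by (simp add: inner_rot det2_diff_right)
    moreover have "rot (C - B) \<noteq> 0" using D by auto
    ultimately have "all_but_one_on_line S" unfolding all_but_one_on_line_def using S(1) by blast
    then show ?thesis unfolding exceptional_def using assms(1) by blast
  next
    case line
    have perm: "{B, C, A} = {A, B, C}" "{C, A, B} = {A, B, C}" by auto
    from line(2) have "all_but_two_on_separating_line S"
    proof (elim disjE)
      assume "\<forall>x\<in>I. \<forall>y\<in>I. det2 (x - A) (y - A) = 0"
      then show ?thesis using vertex_line[OF hull refl _ _ line(1)] pos by blast
    next
      assume "\<forall>x\<in>I. \<forall>y\<in>I. det2 (x - B) (y - B) = 0"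
      then show ?thesis using vertex_line[OF hulls(1) perm(1) _ _ line(1)] pos by blast
    next
      assume "\<forall>x\<in>I. \<forall>y\<in>I. det2 (x - C) (y - C) = 0"
      then show ?thesis using vertex_line[OF hulls(2) perm(2) _ _ line(1)] pos by blast
    qed
    then show ?thesis unfolding exceptional_def using assms(1) by blast
  next
    case three
    \<comment> \<open>If \<open>I\<close> were collinear, a vertex collinear with one pair of its
      points would be on the line of \<open>I\<close> and hence collinear with every pair, which
      case \<open>three\<close> excludes.\<close>
    have transfer: "det2 (x - V) (y - V) = 0"
      if "collinear I" "x \<in> I" "y \<in> I" "u \<in> I" "v \<in> I" "u \<noteq> v" "det2 (u - V) (v - V) = 0" for x y u v V
    proof -
      have par: "\<exists>k. w - u = k *\<^sub>R (v - u)" if "det2 (v - u) (w - u) = 0" for w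
        using det2_eq_0_imp_parallel[of "v - u" "w - u"] \<open>u \<noteq> v\<close> that by auto
      have "collinear {u, v, w}" if "w \<in> I" for w
        by (rule collinear_subset[OF \<open>collinear I\<close>]) (use that \<open>u \<in> I\<close> \<open>v \<in> I\<close> in auto)
      then have dep: "det2 (v - u) (w - u) = 0" if "w \<in> I" for w
        using that by (simp add: collinear_iff_det2)
      obtain k where k: "x - u = k *\<^sub>R (v - u)" using par[OF dep[OF \<open>x \<in> I\<close>]] by blast
      obtain l where l: "y - u = l *\<^sub>R (v - u)" using par[OF dep[OF \<open>y \<in> I\<close>]] by blast
      have "det2 (v - u) (V - u) = 0" using that(7) by (simp add: det2_def algebra_simps)
      then obtain m where m: "V - u = m *\<^sub>R (v - u)" using par by blast
      have "x - V = (x - u) - (V - u)" "y - V = (y - u) - (V - u)" by simp_all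
      then have "x - V = (k - m) *\<^sub>R (v - u)" "y - V = (l - m) *\<^sub>R (v - u)"
        unfolding k l m by (simp_all only: scaleR_left_diff_distrib)
      then show ?thesis by (simp add: det2_scaleR_left det2_scaleR_right)
    qed
    have "\<not> collinear I"
    proof
      assume col: "collinear I"
      obtain u v where uv: "u \<in> I" "v \<in> I" "u \<noteq> v"
        using three(1) by (metis card_3_iff insertCI)
      then show False using some_line[OF uv(1,2)] transfer[OF col _ _ uv] three(2) by blast
    qed
    have ncol: "\<not> collinear {A, B, C}" using D by (simp add: collinear_iff_det2)
    have "nested_triangles S"
      unfolding nested_triangles_def
    proof (rule conjI[OF _ exI[of _ "{A, B, C}", OF exI[of _ I]]]; (intro conjI)?)
      show SI: "S = {A, B, C} \<union> I" unfolding I_def using S by blast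
      have "A \<noteq> B" "A \<noteq> C" "B \<noteq> C" using D by auto
      then show c3: "card {A, B, C} = 3" by simp
      have "finite I" using assms(1) unfolding I_def by simp
      then show "card S = 6"
        unfolding SI using c3 three(1) card_Un_disjoint[of "{A, B, C}" I] by (simp add: I_def)
      show "card I = 3" by (fact three(1))
      show "\<not> collinear {A, B, C}" by (fact ncol)
      show "\<not> collinear I" by fact
      show "I \<subseteq> interior (convex hull {A, B, C})"
      proof
        fix x assume "x \<in> I"
        have "DIM(point) = 2" by simp
        from interior_convex_hull_3_minimal[OF ncol this]
        show "x \<in> interior (convex hull {A, B, C})"
          using pos[OF \<open>x \<in> I\<close>] sum_weights[OF D, of x] weight_combination[OF D, of x, symmetric] by blast
      qed
      show "\<forall>u\<in>I. \<forall>v\<in>I. u \<noteq> v \<longrightarrow> (\<exists>w\<in>{A, B, C}. collinear {u, v, w})"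
      proof (intro ballI impI)
        fix u v assume uv: "u \<in> I" "v \<in> I" "u \<noteq> v"
        have "collinear {u, v, V}" if "det2 (u - V) (v - V) = 0" for V
          using that by (simp add: collinear_iff_det2 det2_def algebra_simps)
        then show "\<exists>w\<in>{A, B, C}. collinear {u, v, w}" using some_line[OF uv(1,2)] by blast
      qed
    qed
    then show ?thesis unfolding exceptional_def using assms(1) by blast
  qed
qed

section \<open>Existence of a cut triangle, and density\<close>

lemma cut_triangle_of_non_exceptional:
  assumes "finite S" "\<not> exceptional S" "S \<subseteq> E" and cc: "crossing_closed E"
  shows "cut_triangle E"
proof (rule ccontr)
  assume ncut: "\<not> cut_triangle E"
  have ncol: "\<not> collinear S" and n1: "\<not> all_but_one_on_line S" and n2: "\<not> all_but_two_on_separating_line S"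
    using assms(1,2) unfolding exceptional_def by auto
  have free: "crossing_free S"
    unfolding crossing_free_def
    using crossing_imp_separating_line[OF cc ncut \<open>S \<subseteq> E\<close>] n2 by blast
  obtain A B C where hull: "hull_triangle S A B C"
    using ex_hull_triangle[OF assms(1) ncol free] .
  have hulls: "hull_triangle S B C A" "hull_triangle S C A B"
    using hull hull_triangle_rotate by blast+
  have "weight A B C x > 0 \<and> weight B C A x > 0 \<and> weight C A B x > 0" if x: "x \<in> S - {A, B, C}" for x
  proof -
    note edge = hull_triangle_edge_point[OF cc ncut \<open>S \<subseteq> E\<close>]
    have "weight A B C x \<noteq> 0" "weight B C A x \<noteq> 0" "weight C A B x \<noteq> 0"
      using edge[OF hull] edge[OF hulls(1)] edge[OF hulls(2)] x n1 n2 by blast+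
    moreover have "weight A B C x \<ge> 0" "weight B C A x \<ge> 0" "weight C A B x \<ge> 0"
      using hull x unfolding hull_triangle_def by auto
    ultimately show ?thesis by simp
  qed
  from interior_points_exceptional[OF assms(1) free hull this] show False using assms(2) by simp
qed

theorem theorem1:
  fixes S :: "point set"
  assumes "finite S" and "\<not> exceptional S"
  shows "dense_in (iterated_limit S) (candidate S)"
proof (rule cut_triangle_dense[OF assms(1)])
  have "S \<subseteq> closure (iterated_limit S)" using subset_iterated_limit closure_subset by blast
  then show "cut_triangle (closure (iterated_limit S))"
    using cut_triangle_of_non_exceptional[OF assms]
      crossing_closed_closure[OF crossing_closed_iterated_limit] by blast
qed

end
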